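(* Let $u$ be a minus one homogeneous solution of the stationary incompressible Navier–Stokes equations $$-\Delta u+(u\cdot\nabla)u+\nabla p=0,\qquad\operatorname{div}u=0\qquad\text{in }\mathbb R^3_+,$$ with the Navier boundary conditions $$u\cdot\nu=0,\qquad\Big((1-\gamma)\frac{\partial u}{\partial\nu}+\gamma u\Big)\times\nu=0\qquad\text{on }\partial\mathbb R^3_+\setminus\{0\},$$ for some $\gamma\in[0,1]$, where $\nu=(0,0,-1)$ is the unit outer normal. If $u$ is axially symmetric with respect to the $x_3$-axis, then $u$ vanishes.
   Context: $\mathbb R^3_+=\{x\in\mathbb R^3:x_3>0\}$, $u:\mathbb R^3_+\to\mathbb R^3$ is the velocity field and $p$ is the pressure. Minus one homogeneous means $u(\lambda x)=\lambda^{-1}u(x)$ for all $\lambda>0$. Axially symmetric means that in spherical coordinates $(\rho,\theta,\varphi)$, with $\rho=|x|$, $\theta$ the azimuthal angle and $\varphi$ the angle between $x$ and the $x_3$-axis, the components of $u$ along $e_\rho,e_\varphi,e_\theta$ do not depend on $\theta$; the component along $e_\theta$ is allowed to be nonzero. Thus $u=\frac1\rho f(\varphi)e_\rho+\frac1\rho g(\varphi)e_\varphi+\frac1\rho h(\varphi)e_\theta$. The case $\gamma=1$ is the zero Dirichlet (no-slip) boundary condition, and $\gamma=0$ is the slip boundary condition for a half space. *)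

theory Defs
  imports "HOL-Analysis.Analysis"
begin

definition half_space :: "(real^3) set"
  where "half_space = {x. x $ 3 > 0}"

definition outer_normal :: "real^3"
  where "outer_normal = vector [0, 0, -1]"

definition partial :: "3 \<Rightarrow> (real^3 \<Rightarrow> 'a::real_normed_vector) \<Rightarrow> real^3 \<Rightarrow> 'a"
  where "partial i f x = frechet_derivative f (at x) (axis i 1)"

text \<open>Class \<open>C^k\<close> on an open set.\<close>
primrec C_on :: "nat \<Rightarrow> (real^3 \<Rightarrow> 'a::real_normed_vector) \<Rightarrow> (real^3) set \<Rightarrow> bool"
  where
    "C_on 0 f S \<longleftrightarrow> continuous_on S f"
  | "C_on (Suc k) f S \<longleftrightarrow> (\<forall>x\<in>S. f differentiable at x) \<and> (\<forall>i. C_on k (partial i f) S)"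

definition gradient :: "(real^3 \<Rightarrow> real) \<Rightarrow> real^3 \<Rightarrow> real^3"
  where "gradient p x = (\<chi> i. partial i p x)"

definition divergence :: "(real^3 \<Rightarrow> real^3) \<Rightarrow> real^3 \<Rightarrow> real"
  where "divergence u x = (\<Sum>i\<in>UNIV. partial i u x $ i)"

definition laplacian :: "(real^3 \<Rightarrow> 'a::real_normed_vector) \<Rightarrow> real^3 \<Rightarrow> 'a"
  where "laplacian u x = (\<Sum>i\<in>UNIV. partial i (partial i u) x)"

definition convection :: "(real^3 \<Rightarrow> real^3) \<Rightarrow> (real^3 \<Rightarrow> real^3) \<Rightarrow> real^3 \<Rightarrow> real^3"
  where "convection v u x = (\<Sum>i\<in>UNIV. v x $ i *\<^sub>R partial i u x)"

text \<open>Classical solutions in the open half space.\<close>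
definition stationary_Navier_Stokes :: "(real^3 \<Rightarrow> real^3) \<Rightarrow> (real^3 \<Rightarrow> real) \<Rightarrow> bool"
  where "stationary_Navier_Stokes u p \<longleftrightarrow>
    C_on 2 u half_space \<and> C_on 1 p half_space \<and>
    (\<forall>x\<in>half_space. - laplacian u x + convection u u x + gradient p x = 0 \<and> divergence u x = 0)"

text \<open>The field is defined only in the closed half space, so the derivative along the outer
  normal at a boundary point is one-sided.\<close>
definition has_normal_derivative :: "(real^3 \<Rightarrow> real^3) \<Rightarrow> real^3 \<Rightarrow> real^3 \<Rightarrow> bool"
  where "has_normal_derivative u D x \<longleftrightarrow>
    ((\<lambda>t. u (x + t *\<^sub>R outer_normal)) has_vector_derivative D) (at 0 within {..0})"

text \<open>The values of \<open>u\<close> on the punctured boundary are those of its continuous extension. For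
  \<open>\<gamma> = 1\<close> the vector \<open>D\<close> has coefficient \<open>0\<close>, and no normal derivative is required to exist.\<close>
definition Navier_boundary_condition :: "real \<Rightarrow> (real^3 \<Rightarrow> real^3) \<Rightarrow> bool"
  where "Navier_boundary_condition \<gamma> u \<longleftrightarrow>
    continuous_on (closure half_space - {0}) u \<and>
    (\<forall>x\<in>frontier half_space - {0}.
      u x \<bullet> outer_normal = 0 \<and>
      (\<exists>D. (\<gamma> \<noteq> 1 \<longrightarrow> has_normal_derivative u D x) \<and>
           cross3 ((1 - \<gamma>) *\<^sub>R D + \<gamma> *\<^sub>R u x) outer_normal = 0))"

definition minus_one_homogeneous :: "(real^3 \<Rightarrow> real^3) \<Rightarrow> bool"
  where "minus_one_homogeneous u \<longleftrightarrow>
    (\<forall>x\<in>half_space. \<forall>c>0. u (c *\<^sub>R x) = inverse c *\<^sub>R u x)"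

text \<open>Spherical coordinates: \<open>\<theta>\<close> is the azimuthal angle, \<open>\<phi>\<close> the angle with the positive
  third axis.\<close>

definition e_rho :: "real \<Rightarrow> real \<Rightarrow> real^3"
  where "e_rho \<theta> \<phi> = vector [sin \<phi> * cos \<theta>, sin \<phi> * sin \<theta>, cos \<phi>]"

definition e_phi :: "real \<Rightarrow> real \<Rightarrow> real^3"
  where "e_phi \<theta> \<phi> = vector [cos \<phi> * cos \<theta>, cos \<phi> * sin \<theta>, - sin \<phi>]"

definition e_theta :: "real \<Rightarrow> real^3"
  where "e_theta \<theta> = vector [- sin \<theta>, cos \<theta>, 0]"

text \<open>The axis \<open>\<phi> = 0\<close> is left out because the frame is not defined there.\<close>
definition axially_symmetric :: "(real^3 \<Rightarrow> real^3) \<Rightarrow> bool"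
  where "axially_symmetric u \<longleftrightarrow>
    (\<forall>\<rho> \<phi> \<theta> \<theta>'. \<rho> > 0 \<longrightarrow> 0 < \<phi> \<longrightarrow> \<phi> < pi / 2 \<longrightarrow>
      u (\<rho> *\<^sub>R e_rho \<theta> \<phi>) \<bullet> e_rho \<theta> \<phi> = u (\<rho> *\<^sub>R e_rho \<theta>' \<phi>) \<bullet> e_rho \<theta>' \<phi> \<and>
      u (\<rho> *\<^sub>R e_rho \<theta> \<phi>) \<bullet> e_phi \<theta> \<phi> = u (\<rho> *\<^sub>R e_rho \<theta>' \<phi>) \<bullet> e_phi \<theta>' \<phi> \<and>
      u (\<rho> *\<^sub>R e_rho \<theta> \<phi>) \<bullet> e_theta \<theta> = u (\<rho> *\<^sub>R e_rho \<theta>' \<phi>) \<bullet> e_theta \<theta>')"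

end

theory Submission
  imports Defs "HOL-Real_Asymp.Real_Asymp"
begin

text \<open>By homogeneity and axial symmetry the flow is determined by the profile $v(z) = u(1, 0, z)$.
  Differentiating the Euler relation and the rotation relation turns the equations into ordinary
  differential equations for $v$. The swirl $v_2$ solves a linear equation without zeroth order
  term, hence is monotone, and the boundary condition together with the decay at the axis kills it.
  With $\psi = v_3 - z v_1$ one has $\psi' = - v_1$; eliminating the pressure from the two remaining
  equations gives a linear second order equation for the Riccati expression
  $W = (1 + z^2) v_1 - z \psi + \psi^2 / 2$, whose solutions are explicit. Decay at the axis
  leaves $W = A (1/2 + z^2 - z \sqrt{1 + z^2})$, with $W(0) = A / 2$ and $W'(0) = - A$: no slip forces
  the first and slip the second to vanish, so $W = 0$. This is a homogeneous linear equation for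
  $\psi$ with $\psi(0) = 0$, so $\psi = 0$ and the flow vanishes.\<close>

section \<open>Ordinary differential equations for the profile\<close>

text \<open>Nothing is assumed about symmetry or homogeneity of \<open>p\<close>, and
  \<open>u\<close> is only C^2 inside and continuous up to the punctured boundary. Hence
  \<open>gradient p\<close> has to inherit degree -3 and equivariance from the equation. It follows
  that \<open>p\<close> has degree -2 up to an additive constant, which enters as \<open>k\<close>,
  and that \<open>p\<close> does not change along circles about the axis. Cross-differentiation
  would cost a derivative. Instead, the momentum component orthogonal to the ray from the origin is
  an exact derivative and yields the constant \<open>K\<close>; inserting it into the radial
  component gives the second order equation for W. Near the axis z^2 v_1 tends to some a and z v_3
  to 2 a, where the factor 2 expresses incompressibility. With these values the limits of the terms
  of W cancel. For 0 < \<gamma> < 1 the two terms of the Navier condition scale with different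
  degrees along a ray, so each vanishes and the case reduces to no slip. With z the cotangent of the
  polar angle \<phi>, the decaying solution is W = (A / 2) tan^2 (\<phi> / 2).\<close>

lemma constant_on_pos:
  fixes f :: "real \<Rightarrow> real"
  assumes "\<And>z. z > 0 \<Longrightarrow> (f has_real_derivative 0) (at z)"
  shows "\<exists>c. \<forall>z>0. f z = c"
proof -
  have "\<exists>c. \<forall>z\<in>{0<..}. f z = c"
    by (rule has_field_derivative_zero_constant) (auto intro: has_field_derivative_at_within assms)
  then show ?thesis by auto
qed

text \<open>Integrating factor \<open>exp (- M z)\<close>. As \<open>M\<close> tends to 0,
  \<open>C\<close> is the right limit of \<open>f\<close> at 0; this is how boundary data at 0 enter
  an equation that holds for z > 0 only.\<close>

lemma linear_ode_solution:
  fixes f m :: "real \<Rightarrow> real"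
  assumes m: "continuous_on {0..} m"
    and f: "\<And>z. z > 0 \<Longrightarrow> (f has_real_derivative m z * f z) (at z)"
  obtains C M where "(M \<longlongrightarrow> 0) (at_right 0)" "\<And>z. z > 0 \<Longrightarrow> f z = C * exp (M z)"
proof -
  define M where "M z = integral {0..z} m" for z
  have M_within: "(M has_real_derivative m t) (at t within {0..b})" if "0 \<le> t" "t \<le> b" for t b
    unfolding M_def using that
    by (intro integral_has_real_derivative continuous_on_subset[OF m]) auto
  have M_at: "(M has_real_derivative m t) (at t)" if "0 < t" for t
    using M_within[of t "t + 1"] that by (simp add: at_within_Icc_at)
  have *: "((\<lambda>z. f z * exp (- M z)) has_real_derivative 0) (at z)" if "z > 0" for z
    by (rule derivative_eq_intros f M_at that refl | simp)+
  obtain C where C: "\<And>z. z > 0 \<Longrightarrow> f z * exp (- M z) = C"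
    using constant_on_pos[OF *] by blast
  have "(M \<longlongrightarrow> M 0) (at 0 within {0..1})"
    using M_within[of 0 1] DERIV_continuous by (fastforce simp: continuous_within)
  moreover have "M 0 = 0" by (simp add: M_def)
  ultimately have "(M \<longlongrightarrow> 0) (at_right 0)" by (simp add: at_within_Icc_at_right)
  moreover have "f z = C * exp (M z)" if "z > 0" for z
    using C[OF that] by (auto simp: exp_minus field_simps)
  ultimately show ?thesis by (rule that)
qed

text \<open>L'Hopital's rule for the difference quotient. The boundary condition supplies only a
  one-sided derivative at 0, which has to be linked to the derivative in the interior.\<close>

lemma right_derivative_eq_limit:
  fixes f :: "real \<Rightarrow> real"
  assumes f: "\<And>z. z > 0 \<Longrightarrow> (f has_real_derivative f' z) (at z)"
    and f0: "(f has_real_derivative D) (at 0 within {0..})"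
    and L: "(f' \<longlongrightarrow> L) (at_right 0)"
  shows "L = D"
proof -
  have within: "at 0 within {0..} = at_right (0::real)"
    by (metis at_within_Ici_at_right)
  have "((\<lambda>z. (f z - f 0) / z) \<longlongrightarrow> D) (at_right 0)"
    using f0 by (simp add: has_field_derivative_iff within)
  moreover have "((\<lambda>z. (f z - f 0) / z) \<longlongrightarrow> L) (at_right 0)"
  proof (rule lhopital_right_0)
    have "(f \<longlongrightarrow> f 0) (at_right 0)"
      using DERIV_continuous[OF f0] by (simp add: continuous_within within)
    then show "((\<lambda>z. f z - f 0) \<longlongrightarrow> 0) (at_right 0)" by (simp add: LIM_zero)
    show "\<forall>\<^sub>F z in at_right 0. ((\<lambda>z. f z - f 0) has_real_derivative f' z) (at z)"
      unfolding eventually_at_right_field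
      by (auto intro!: exI[of _ 1] derivative_eq_intros f)
    show "((\<lambda>z. f' z / 1) \<longlongrightarrow> L) (at_right 0)" using L by simp
  qed (auto simp: eventually_at_right_field intro!: tendsto_eq_intros exI[of _ 1])
  ultimately show ?thesis
    using tendsto_unique trivial_limit_at_right_real by blast
qed

lemma increasing_not_vanishing:
  fixes f :: "real \<Rightarrow> real"
  assumes f: "\<And>z. z > 0 \<Longrightarrow> (f has_real_derivative f' z) (at z)"
    and pos: "\<And>z. z > 0 \<Longrightarrow> f' z > 0"
    and cont: "continuous_on {0..} f" and f0: "f 0 = 0" and lim: "(f \<longlongrightarrow> 0) at_top"
  shows False
proof -
  have mono: "f a < f b" if "0 \<le> a" "a < b" for a b
  proof (rule DERIV_pos_imp_increasing_open[OF that(2)])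
    show "continuous_on {a..b} f" using that by (intro continuous_on_subset[OF cont]) auto
    show "\<exists>y. (f has_real_derivative y) (at x) \<and> y > 0" if "a < x" "x < b" for x
      using f[of x] pos[of x] \<open>0 \<le> a\<close> that by (intro exI[of _ "f' x"]) simp
  qed
  have "\<forall>\<^sub>F z in at_top. f 1 \<le> f z"
    using eventually_gt_at_top[of 1] by eventually_elim (use mono[of 1] in force)
  then have "f 1 \<le> 0" using tendsto_lowerbound[OF lim] by simp
  then show False using mono[of 0 1] f0 by simp
qed

text \<open>\<open>f'\<close> is a constant times an exponential, so it has a fixed sign. If the
  constant is nonzero, \<open>f\<close> is strictly monotone and cannot both start at 0 and tend to
  0. Under the slip condition the constant equals the one-sided derivative at 0.\<close>

lemma swirl_vanishes:
  fixes f f' f'' m :: "real \<Rightarrow> real"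
  assumes f: "\<And>z. z > 0 \<Longrightarrow> (f has_real_derivative f' z) (at z)"
    and f': "\<And>z. z > 0 \<Longrightarrow> (f' has_real_derivative m z * f' z) (at z)"
    and m: "continuous_on {0..} m"
    and cont: "continuous_on {0..} f" and lim: "(f \<longlongrightarrow> 0) at_top"
    and bc: "f 0 = 0 \<or> (f has_real_derivative 0) (at 0 within {0..})"
    and "z > 0"
  shows "f z = 0"
proof -
  obtain C M where M: "(M \<longlongrightarrow> 0) (at_right 0)" and C: "\<And>z. z > 0 \<Longrightarrow> f' z = C * exp (M z)"
    using linear_ode_solution[OF m f'] by blast
  have "C = 0"
  proof (cases "(f has_real_derivative 0) (at 0 within {0..})")
    case True
    have "((\<lambda>z. C * exp (M z)) \<longlongrightarrow> C * exp 0) (at_right 0)"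
      by (intro tendsto_intros M)
    moreover have "\<forall>\<^sub>F z in at_right 0. C * exp (M z) = f' z"
      by (auto simp: eventually_at_right_field C intro!: exI[of _ 1])
    ultimately have "(f' \<longlongrightarrow> C) (at_right 0)"
      by (simp add: tendsto_cong)
    then show ?thesis using right_derivative_eq_limit[OF f True] by simp
  next
    case False
    then have f0: "f 0 = 0" using bc by blast
    show ?thesis
    proof (rule ccontr)
      assume "C \<noteq> 0"
      then consider "C > 0" | "C < 0" by linarith
      then show False
      proof cases
        case 1
        show False
          by (rule increasing_not_vanishing[of f f']) (use f C 1 cont f0 lim in auto)
      next
        case 2
        show False
        proof (rule increasing_not_vanishing[of "\<lambda>z. - f z" "\<lambda>z. - f' z"])
          show "((\<lambda>z. - f z) \<longlongrightarrow> 0) at_top" using tendsto_minus[OF lim] by simp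
        qed (use f C 2 cont f0 in \<open>auto intro!: DERIV_minus continuous_on_minus simp: mult_neg_pos\<close>)
      qed
    qed
  qed
  then have *: "(f has_real_derivative 0) (at z)" if "z > 0" for z
    using f[OF that] C[OF that] by simp
  obtain c where c: "\<And>z. z > 0 \<Longrightarrow> f z = c" using constant_on_pos[OF *] by blast
  then have "(f \<longlongrightarrow> c) at_top"
    by (intro tendsto_eventually) (use eventually_gt_at_top[of 0] in \<open>eventually_elim, auto\<close>)
  then have "c = 0" using lim tendsto_unique trivial_limit_at_top_linorder by blast
  with c \<open>z > 0\<close> show ?thesis by simp
qed

text \<open>The constant \<open>K\<close> is a particular solution, and the homogeneous equation has
  the solutions 1 + z^2 and z sqrt (1 + z^2). The proof is reduction of order by the first of
  them.\<close>

lemma legendre_type_solution: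
  fixes W W' W'' :: "real \<Rightarrow> real"
  assumes W: "\<And>z. z > 0 \<Longrightarrow> (W has_real_derivative W' z) (at z)"
    and W': "\<And>z. z > 0 \<Longrightarrow> (W' has_real_derivative W'' z) (at z)"
    and ode: "\<And>z. z > 0 \<Longrightarrow> (1 + z\<^sup>2)\<^sup>2 * W'' z = z * (1 + z\<^sup>2) * W' z + 2 * (W z - K)"
  obtains A B where "\<And>z. z > 0 \<Longrightarrow> W z = K + A * (1 + z\<^sup>2) + B * (z * sqrt (1 + z\<^sup>2))"
proof -
  define s where "s z = sqrt (1 + z\<^sup>2)" for z :: real
  have pos: "1 + z\<^sup>2 > 0" for z :: real by (simp add: add_pos_nonneg)
  have s2: "s z * s z = 1 + z\<^sup>2" and s_pos: "s z > 0" for z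
    using pos by (simp_all add: s_def real_sqrt_mult_self abs_of_pos)
  have s: "(s has_real_derivative z / s z) (at z)" for z
    unfolding s_def using pos[of z] by (auto intro!: derivative_eq_intros simp: field_simps)
  \<comment> \<open>This is the Wronskian of 1 + z^2 and \<open>W - K\<close>, divided by
    \<open>s\<close>. It is constant by Abel's formula, since the coefficient z / (1 + z^2) of
    \<open>W'\<close> is the logarithmic derivative of \<open>s\<close>.\<close>
  have *: "((\<lambda>z. s z * W' z - 2 * z * (W z - K) / s z) has_real_derivative 0) (at z)"
    if "z > 0" for z
  proof -
    have "((\<lambda>z. s z * W' z - 2 * z * (W z - K) / s z) has_real_derivative
        (z / s z * W' z + s z * W'' z)
        - ((2 * (W z - K) + 2 * z * W' z) * s z - 2 * z * (W z - K) * (z / s z)) / (s z * s z)) (at z)"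
      using s_pos[of z]
      by (auto intro!: derivative_eq_intros s W[OF that] W'[OF that] simp: algebra_simps)
    moreover have "(z / s z * W' z + s z * W'' z)
        - ((2 * (W z - K) + 2 * z * W' z) * s z - 2 * z * (W z - K) * (z / s z)) / (s z * s z) = 0"
      (is "?l = 0")
    proof -
      have "?l * (s z * s z * s z) = z * (s z * s z) * W' z + (s z * s z) * (s z * s z) * W'' z
          - (2 * (W z - K) + 2 * z * W' z) * (s z * s z) + 2 * z\<^sup>2 * (W z - K)"
        using s_pos[of z] by (simp add: field_simps power2_eq_square)
      also have "\<dots> = (1 + z\<^sup>2)\<^sup>2 * W'' z - (z * (1 + z\<^sup>2) * W' z + 2 * (W z - K))"
        unfolding s2 by algebra
      finally show ?thesis using ode[OF that] s_pos[of z] by auto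
    qed
    ultimately show ?thesis by simp
  qed
  obtain B where B: "s z * W' z - 2 * z * (W z - K) / s z = B" if "z > 0" for z
    using constant_on_pos[OF *] by blast
  \<comment> \<open>By the first integral the derivative of (W - K) / s^2 is B / s^3, and z / s has
    derivative 1 / s^3.\<close>
  have *: "((\<lambda>z. (W z - K) / (s z * s z) - B * (z / s z)) has_real_derivative 0) (at z)"
    if "z > 0" for z
  proof -
    have "((\<lambda>z. (W z - K) / (s z * s z) - B * (z / s z)) has_real_derivative
        (W' z * (s z * s z) - (W z - K) * (2 * z)) / ((s z * s z) * (s z * s z))
        - B * ((s z - z * (z / s z)) / (s z * s z))) (at z)"
      using s_pos[of z]
      by (auto intro!: derivative_eq_intros s W[OF that] simp: field_simps)
    moreover have "(W' z * (s z * s z) - (W z - K) * (2 * z)) / ((s z * s z) * (s z * s z))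
        - B * ((s z - z * (z / s z)) / (s z * s z)) = 0" (is "?l = 0")
    proof -
      have "?l * (s z * s z * (s z * s z))
        = s z * (s z * W' z - 2 * z * (W z - K) / s z) - B * s z * (s z * s z - z\<^sup>2)"
        using s_pos[of z] by (simp add: field_simps power2_eq_square)
      also have "\<dots> = 0" unfolding B[OF that] s2 by algebra
      finally show ?thesis using s_pos[of z] by auto
    qed
    ultimately show ?thesis by simp
  qed
  obtain A where A: "(W z - K) / (s z * s z) - B * (z / s z) = A" if "z > 0" for z
    using constant_on_pos[OF *] by blast
  have "W z = K + A * (1 + z\<^sup>2) + B * (z * sqrt (1 + z\<^sup>2))" if "z > 0" for z
  proof -
    have "x = (x / (r * r) - B * (z / r)) * (r * r) + B * (z * r)" if "r > 0" for x r :: real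
      using that by (simp add: field_simps)
    from this[OF s_pos] have "W z - K = A * (s z * s z) + B * (z * s z)"
      using A[OF that] by metis
    then show ?thesis unfolding s2 by (simp add: s_def)
  qed
  then show ?thesis by (rule that)
qed

lemma limit_of_eventually_constant:
  fixes f :: "'a \<Rightarrow> real"
  assumes "(f \<longlongrightarrow> l) F" "\<forall>\<^sub>F x in F. f x = c" "F \<noteq> bot"
  shows "l = c"
  using tendsto_unique[OF assms(3,1) tendsto_eventually[OF assms(2)]] .

text \<open>Both unbounded terms grow like z^2, so division by 1 + z^2 gives A = -B. Their
  difference then tends to A / 2, which forces K = - A / 2. What remains is A (sqrt (1 + z^2) - z)^2
  / 2.\<close>

lemma legendre_type_decay:
  fixes W :: "real \<Rightarrow> real"
  assumes W: "\<And>z. z > 0 \<Longrightarrow> W z = K + A * (1 + z\<^sup>2) + B * (z * sqrt (1 + z\<^sup>2))"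
    and lim: "(W \<longlongrightarrow> 0) at_top" and "z > 0"
  shows "W z = A * (1 / 2 + z\<^sup>2 - z * sqrt (1 + z\<^sup>2))"
proof -
  have l1: "((\<lambda>z::real. z * sqrt (1 + z\<^sup>2) / (1 + z\<^sup>2)) \<longlongrightarrow> 1) at_top"
    by real_asymp
  have l2: "((\<lambda>z::real. 1 / (1 + z\<^sup>2)) \<longlongrightarrow> 0) at_top"
    by real_asymp
  have "((\<lambda>z. W z * (1 / (1 + z\<^sup>2)) - K * (1 / (1 + z\<^sup>2)) - B * (z * sqrt (1 + z\<^sup>2) / (1 + z\<^sup>2)))
      \<longlongrightarrow> 0 * 0 - K * 0 - B * 1) at_top"
    by (intro tendsto_intros lim l1 l2)
  moreover have "\<forall>\<^sub>F z in at_top. W z * (1 / (1 + z\<^sup>2)) - K * (1 / (1 + z\<^sup>2))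
      - B * (z * sqrt (1 + z\<^sup>2) / (1 + z\<^sup>2)) = A"
    using eventually_gt_at_top[of 0]
  proof eventually_elim
    case (elim z)
    have "(K + A * s + B * r) * (1 / s) - K * (1 / s) - B * (r / s) = A" if "s \<noteq> 0" for s r
      using that by (simp add: field_simps)
    moreover have "1 + z\<^sup>2 \<noteq> 0" by (smt (verit) zero_le_power2)
    ultimately show ?case unfolding W[OF elim] by blast
  qed
  ultimately have "0 * 0 - K * 0 - B * 1 = A"
    by (rule limit_of_eventually_constant) simp
  then have "A = - B" by simp
  have l3: "((\<lambda>z::real. 1 + z\<^sup>2 - z * sqrt (1 + z\<^sup>2)) \<longlongrightarrow> 1 / 2) at_top"
    by real_asymp
  have "((\<lambda>z. W z - A * (1 + z\<^sup>2 - z * sqrt (1 + z\<^sup>2))) \<longlongrightarrow> 0 - A * (1 / 2)) at_top"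
    by (intro tendsto_intros lim l3)
  moreover have "\<forall>\<^sub>F z in at_top. W z - A * (1 + z\<^sup>2 - z * sqrt (1 + z\<^sup>2)) = K"
    using eventually_gt_at_top[of 0]
  proof eventually_elim
    case (elim z)
    show ?case unfolding W[OF elim] \<open>A = - B\<close> by (simp add: algebra_simps)
  qed
  ultimately have "0 - A * (1 / 2) = K"
    by (rule limit_of_eventually_constant) simp
  then show ?thesis
    using W[OF \<open>z > 0\<close>] \<open>A = - B\<close> by (simp add: algebra_simps)
qed

text \<open>In the application \<open>v1\<close>, \<open>v2\<close>, \<open>v3\<close> are the
  components of u at (1, 0, z), \<open>d1\<close> to \<open>e3\<close> their first and second
  derivatives, \<open>q\<close> the pressure there and \<open>r\<close> its derivative. The term
  \<open>k - 2 * q z - z * r z\<close> is the first partial derivative of the pressure. The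
  alternatives in \<open>bc\<close> are no slip and slip.\<close>

lemma profile_vanishes:
  fixes v1 v2 v3 d1 d2 d3 e1 e2 e3 q r :: "real \<Rightarrow> real"
  assumes v1: "\<And>z. z > 0 \<Longrightarrow> (v1 has_real_derivative d1 z) (at z)"
    and v2: "\<And>z. z > 0 \<Longrightarrow> (v2 has_real_derivative d2 z) (at z)"
    and v3: "\<And>z. z > 0 \<Longrightarrow> (v3 has_real_derivative d3 z) (at z)"
    and d1: "\<And>z. z > 0 \<Longrightarrow> (d1 has_real_derivative e1 z) (at z)"
    and d2: "\<And>z. z > 0 \<Longrightarrow> (d2 has_real_derivative e2 z) (at z)"
    and d3: "\<And>z. z > 0 \<Longrightarrow> (d3 has_real_derivative e3 z) (at z)"
    and q: "\<And>z. z > 0 \<Longrightarrow> (q has_real_derivative r z) (at z)"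
    and div: "\<And>z. z > 0 \<Longrightarrow> d3 z = z * d1 z"
    and mom1: "\<And>z. z > 0 \<Longrightarrow> (1 + z\<^sup>2) * e1 z + 3 * z * d1 z
      = (v3 z - z * v1 z) * d1 z - (v1 z)\<^sup>2 - (v2 z)\<^sup>2 + (k - 2 * q z - z * r z)"
    and mom2: "\<And>z. z > 0 \<Longrightarrow> (1 + z\<^sup>2) * e2 z + 3 * z * d2 z = (v3 z - z * v1 z) * d2 z"
    and mom3: "\<And>z. z > 0 \<Longrightarrow> (1 + z\<^sup>2) * e3 z + 3 * z * d3 z + v3 z
      = (v3 z - z * v1 z) * d3 z - v1 z * v3 z + r z"
    and cont1: "continuous_on {0..} v1" and cont2: "continuous_on {0..} v2"
    and cont3: "continuous_on {0..} v3"
    and impermeable: "v3 0 = 0"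
    and bc: "v1 0 = 0 \<and> v2 0 = 0 \<or>
      (v1 has_real_derivative 0) (at 0 within {0..}) \<and>
      (v2 has_real_derivative 0) (at 0 within {0..}) \<and>
      (\<exists>D. (v3 has_real_derivative D) (at 0 within {0..}))"
    and lim1: "((\<lambda>z. z\<^sup>2 * v1 z) \<longlongrightarrow> a) at_top"
    and lim2: "(v2 \<longlongrightarrow> 0) at_top"
    and lim3: "((\<lambda>z. z * v3 z) \<longlongrightarrow> 2 * a) at_top"
    and "z > 0"
  shows "v1 z = 0 \<and> v2 z = 0 \<and> v3 z = 0"
proof -
  have pos: "1 + z\<^sup>2 > 0" for z :: real by (simp add: add_pos_nonneg)
  \<comment> \<open>In the spherical frame \<open>\<psi>\<close> is minus the coefficient g of the
    e_phi component, as a function of z = cot \<phi>.\<close>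
  define \<psi> where "\<psi> z = v3 z - z * v1 z" for z
  have \<psi>_cont: "continuous_on {0..} \<psi>"
    unfolding \<psi>_def by (intro continuous_intros cont1 cont3)
  have \<psi>0: "\<psi> 0 = 0" by (simp add: \<psi>_def impermeable)
  have \<psi>: "(\<psi> has_real_derivative - v1 z) (at z)" if "z > 0" for z
    unfolding \<psi>_def by (rule derivative_eq_intros v1 v3 that refl | simp add: div that)+
  have v2_0: "v2 z = 0" if "z > 0" for z
  proof (rule swirl_vanishes[where f = v2 and m = "\<lambda>z. (\<psi> z - 3 * z) / (1 + z\<^sup>2)"])
    show "(d2 has_real_derivative (\<psi> z - 3 * z) / (1 + z\<^sup>2) * d2 z) (at z)" if "z > 0" for z
    proof -
      have "e2 z = (\<psi> z - 3 * z) / (1 + z\<^sup>2) * d2 z"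
        using mom2[OF that] pos[of z] by (simp add: \<psi>_def field_simps)
      then show ?thesis using d2[OF that] by simp
    qed
    show "continuous_on {0..} (\<lambda>z. (\<psi> z - 3 * z) / (1 + z\<^sup>2))"
      by (intro continuous_intros \<psi>_cont ballI less_imp_neq[OF pos, symmetric])
  qed (use v2 cont2 lim2 bc that in auto)
  have e3: "e3 z = d1 z + z * e1 z" if "z > 0" for z
  proof -
    have "((\<lambda>z. z * d1 z) has_real_derivative d1 z + z * e1 z) (at z)"
      by (rule derivative_eq_intros d1 that refl | simp)+
    moreover have "\<forall>\<^sub>F y in nhds z. d3 y = y * d1 y"
      using eventually_nhds_in_open[of "{0<..}" z] that by (auto elim!: eventually_mono simp: div)
    ultimately have "(d3 has_real_derivative d1 z + z * e1 z) (at z)"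
      by (simp add: DERIV_cong_ev)
    then show ?thesis using d3[OF that] DERIV_unique by blast
  qed
  define W where "W z = (1 + z\<^sup>2) * v1 z - z * \<psi> z + (\<psi> z)\<^sup>2 / 2" for z
  define W' where "W' z = (1 + z\<^sup>2) * d1 z + 3 * z * v1 z - \<psi> z - \<psi> z * v1 z" for z
  define W'' where "W'' z = (1 + z\<^sup>2) * e1 z + 5 * z * d1 z + 4 * v1 z - \<psi> z * d1 z + (v1 z)\<^sup>2" for z
  have W: "(W has_real_derivative W' z) (at z)" if "z > 0" for z
    unfolding W_def W'_def
    by (rule derivative_eq_intros v1 \<psi> that refl | simp add: algebra_simps)+
  have W': "(W' has_real_derivative W'' z) (at z)" if "z > 0" for z
    unfolding W'_def W''_def
    by (rule derivative_eq_intros v1 d1 \<psi> that refl | simp add: algebra_simps power2_eq_square)+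
  \<comment> \<open>\<open>mom3\<close> minus z times \<open>mom1\<close> is the momentum equation
    in the direction (-z, 0, 1), orthogonal to the ray. The second derivatives cancel, and without
    swirl the rest is the derivative of this expression.\<close>
  have *: "((\<lambda>z. (1 + z\<^sup>2) * (q z - k / 2) - (1 + z\<^sup>2) * v1 z - z * \<psi> z + (\<psi> z)\<^sup>2 / 2)
      has_real_derivative 0) (at z)" if "z > 0" for z
  proof -
    have "2 * z * (q z - k / 2) + (1 + z\<^sup>2) * r z - 2 * z * v1 z - (1 + z\<^sup>2) * d1 z
        - \<psi> z + z * v1 z - \<psi> z * v1 z = 0"
      using mom1[OF that] mom3[OF that] v2_0[OF that]
      unfolding e3[OF that] div[OF that] \<psi>_def by algebra
    moreover have "((\<lambda>z. (1 + z\<^sup>2) * (q z - k / 2) - (1 + z\<^sup>2) * v1 z - z * \<psi> z + (\<psi> z)\<^sup>2 / 2)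
      has_real_derivative 2 * z * (q z - k / 2) + (1 + z\<^sup>2) * r z - 2 * z * v1 z - (1 + z\<^sup>2) * d1 z
        - \<psi> z + z * v1 z - \<psi> z * v1 z) (at z)"
      by (rule derivative_eq_intros q v1 \<psi> that refl | simp add: algebra_simps)+
    ultimately show ?thesis by simp
  qed
  obtain K where K: "(1 + z\<^sup>2) * (q z - k / 2) - (1 + z\<^sup>2) * v1 z - z * \<psi> z + (\<psi> z)\<^sup>2 / 2 = K"
    if "z > 0" for z
    using constant_on_pos[OF *] by blast
  have ode: "(1 + z\<^sup>2)\<^sup>2 * W'' z = z * (1 + z\<^sup>2) * W' z + 2 * (W z - K)" if "z > 0" for z
  proof -
    \<comment> \<open>This is \<open>mom1\<close> plus z times \<open>mom3\<close>, the radial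
      component: \<open>r\<close> drops out, so the pressure occurs only through \<open>q\<close>,
      which \<open>K\<close> eliminates.\<close>
    have "(1 + z\<^sup>2) * ((1 + z\<^sup>2) * e1 z + z * d1 z) + 3 * z * (1 + z\<^sup>2) * d1 z + z * v3 z
        - (\<psi> z * (1 + z\<^sup>2) * d1 z - (v1 z)\<^sup>2 - z * v1 z * v3 z + (k - 2 * q z)) = 0" (is "?m = 0")
    proof -
      have "?m = ((1 + z\<^sup>2) * e1 z + 3 * z * d1 z
          - ((v3 z - z * v1 z) * d1 z - (v1 z)\<^sup>2 - (v2 z)\<^sup>2 + (k - 2 * q z - z * r z)))
          + z * ((1 + z\<^sup>2) * e3 z + 3 * z * d3 z + v3 z
          - ((v3 z - z * v1 z) * d3 z - v1 z * v3 z + r z))"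
        unfolding e3[OF that] div[OF that] \<psi>_def v2_0[OF that]
        by (simp add: algebra_simps power2_eq_square)
      then show ?thesis using mom1[OF that] mom3[OF that] by simp
    qed
    moreover have "(1 + z\<^sup>2)\<^sup>2 * W'' z - (z * (1 + z\<^sup>2) * W' z + 2 * (W z - K)) = (1 + z\<^sup>2) * ?m"
      unfolding W''_def W'_def W_def K[OF that, symmetric] \<psi>_def
      by (simp add: field_simps power2_eq_square)
    ultimately show ?thesis by simp
  qed
  obtain A B where W_form: "\<And>z. z > 0 \<Longrightarrow> W z = K + A * (1 + z\<^sup>2) + B * (z * sqrt (1 + z\<^sup>2))"
    using legendre_type_solution[OF W W' ode] by blast
  have W_lim: "(W \<longlongrightarrow> 0) at_top"
  proof -
    have inv: "((\<lambda>z::real. 1 / z) \<longlongrightarrow> 0) at_top" by real_asymp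
    have inv2: "((\<lambda>z::real. 1 / z\<^sup>2) \<longlongrightarrow> 0) at_top" by real_asymp
    \<comment> \<open>The part (1 + z^2) v1 tends to a and z \<open>\<psi>\<close> to 2 a - a, so
      they cancel, while \<open>\<psi>\<close> itself tends to 0.\<close>
    have "((\<lambda>z. (1 / z\<^sup>2) * (z\<^sup>2 * v1 z) + z\<^sup>2 * v1 z - (z * v3 z - z\<^sup>2 * v1 z)
        + ((1 / z) * (z * v3 z - z\<^sup>2 * v1 z))\<^sup>2 / 2) \<longlongrightarrow>
        0 * a + a - (2 * a - a) + (0 * (2 * a - a))\<^sup>2 / 2) at_top"
      by (intro tendsto_intros inv inv2 lim1 lim3) auto
    moreover have "\<forall>\<^sub>F z in at_top. (1 / z\<^sup>2) * (z\<^sup>2 * v1 z) + z\<^sup>2 * v1 z - (z * v3 z - z\<^sup>2 * v1 z)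
        + ((1 / z) * (z * v3 z - z\<^sup>2 * v1 z))\<^sup>2 / 2 = W z"
      using eventually_gt_at_top[of 0]
      by eventually_elim (simp add: W_def \<psi>_def field_simps power2_eq_square)
    ultimately show ?thesis by (simp add: tendsto_cong)
  qed
  have W_eq: "W z = A * (1 / 2 + z\<^sup>2 - z * sqrt (1 + z\<^sup>2))" if "z > 0" for z
    by (rule legendre_type_decay[OF _ W_lim that]) (rule W_form)
  have W_cont: "continuous_on {0..} W"
    unfolding W_def by (intro continuous_intros cont1 \<psi>_cont) auto
  have within: "at 0 within {0..} = at_right (0::real)"
    by (metis at_within_Ici_at_right)
  define w where "w z = A * (1 / 2 + z\<^sup>2 - z * sqrt (1 + z\<^sup>2))" for z :: real
  have W0: "W 0 = A / 2"
  proof -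
    have "(w \<longlongrightarrow> A * (1 / 2 + 0\<^sup>2 - 0 * sqrt (1 + 0\<^sup>2))) (at_right 0)"
      unfolding w_def by (intro tendsto_intros)
    moreover have "\<forall>\<^sub>F z in at_right 0. w z = W z"
      by (auto simp: eventually_at_right_field W_eq w_def intro!: exI[of _ 1])
    ultimately have "(W \<longlongrightarrow> A * (1 / 2 + 0\<^sup>2 - 0 * sqrt (1 + 0\<^sup>2))) (at_right 0)"
      by (rule Lim_transform_eventually)
    moreover have "(W \<longlongrightarrow> W 0) (at_right 0)"
      using W_cont unfolding continuous_on_def within[symmetric] by simp
    ultimately show ?thesis
      using tendsto_unique[OF trivial_limit_at_right_real] by fastforce
  qed
  have "A = 0"
    using bc
  proof (elim disjE conjE exE)
    assume "v1 0 = 0"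
    then show ?thesis using W0 by (simp add: W_def \<psi>0)
  next
    fix D
    assume v1': "(v1 has_real_derivative 0) (at 0 within {0..})"
      and v3': "(v3 has_real_derivative D) (at 0 within {0..})"
    have \<psi>': "(\<psi> has_real_derivative D - v1 0) (at 0 within {0..})"
      unfolding \<psi>_def by (rule derivative_eq_intros v1' v3' refl | simp)+
    \<comment> \<open>At 0 every term of the derivative carries a factor z, \<open>\<psi> 0\<close>
      or the derivative of \<open>v1\<close>, and all three are 0.\<close>
    have "(W has_real_derivative 0) (at 0 within {0..})"
      unfolding W_def by (rule derivative_eq_intros v1' \<psi>' refl | simp add: \<psi>0)+
    moreover have "(w has_real_derivative - A) (at 0 within {0..})"
      unfolding w_def by (rule derivative_eq_intros refl | simp)+
    moreover have "W z = w z" if "z \<in> {0..}" for z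
      using that W0 W_eq by (cases "z = 0") (auto simp: w_def)
    ultimately have "(W has_real_derivative 0) (at 0 within {0..})"
      "(W has_real_derivative - A) (at 0 within {0..})"
      using has_field_derivative_transform_within[of w "- A" 0 "{0..}" 1 W] by simp_all
    then have "0 = - A"
      using vector_derivative_unique_within[of 0 "{0..}" W 0 "- A"] within
      by (simp add: has_real_derivative_iff_has_vector_derivative trivial_limit_at_right_real)
    then show ?thesis by simp
  qed
  \<comment> \<open>The equation W = 0 is quadratic in \<open>\<psi>\<close>. Writing it with a
    coefficient that contains \<open>\<psi>\<close> itself, and reading that coefficient as a given
    continuous function, makes \<open>linear_ode_solution\<close> applicable.\<close>
  have \<psi>_ode: "(\<psi> has_real_derivative (\<psi> z / 2 - z) / (1 + z\<^sup>2) * \<psi> z) (at z)" if "z > 0" for z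
  proof -
    have "- v1 z = (\<psi> z / 2 - z) / (1 + z\<^sup>2) * \<psi> z"
      using W_eq[OF that] \<open>A = 0\<close> pos[of z] unfolding W_def
      by (simp add: field_simps power2_eq_square)
    then show ?thesis using \<psi>[OF that] by simp
  qed
  have "continuous_on {0..} (\<lambda>z. (\<psi> z / 2 - z) / (1 + z\<^sup>2))"
    by (intro continuous_intros \<psi>_cont ballI less_imp_neq[OF pos, symmetric]) auto
  then obtain C M where M: "(M \<longlongrightarrow> 0) (at_right 0)" and C: "\<And>z. z > 0 \<Longrightarrow> \<psi> z = C * exp (M z)"
    using linear_ode_solution[OF _ \<psi>_ode] by blast
  have "((\<lambda>z. C * exp (M z)) \<longlongrightarrow> C * exp 0) (at_right 0)"
    by (intro tendsto_intros M)
  moreover have "\<forall>\<^sub>F z in at_right 0. C * exp (M z) = \<psi> z"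
    by (auto simp: eventually_at_right_field C intro!: exI[of _ 1])
  ultimately have "(\<psi> \<longlongrightarrow> C * exp 0) (at_right 0)"
    by (rule Lim_transform_eventually)
  moreover have "(\<psi> \<longlongrightarrow> \<psi> 0) (at_right 0)"
    using \<psi>_cont unfolding continuous_on_def within[symmetric] by simp
  ultimately have "C = 0"
    using tendsto_unique[OF trivial_limit_at_right_real] \<psi>0 by fastforce
  then have "\<psi> z = 0" if "z > 0" for z using C[OF that] by simp
  moreover from this have "v1 z = 0" if "z > 0" for z
    using \<psi>_ode[OF that] \<psi>[OF that] DERIV_unique that by fastforce
  ultimately show ?thesis using \<open>z > 0\<close> v2_0 by (auto simp: \<psi>_def)
qed

section \<open>Homogeneous and rotationally equivariant fields\<close>

lemma has_derivative_partial:
  assumes "f differentiable at x"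
  shows "(f has_derivative (\<lambda>h. \<Sum>i\<in>UNIV. h $ i *\<^sub>R partial i f x)) (at x)"
proof -
  let ?D = "frechet_derivative f (at x)"
  have D: "(f has_derivative ?D) (at x)"
    using assms frechet_derivative_works by blast
  then interpret linear ?D by (rule has_derivative_linear)
  have "?D h = (\<Sum>i\<in>UNIV. h $ i *\<^sub>R partial i f x)" for h
  proof -
    have "h = (\<Sum>i\<in>UNIV. h $ i *\<^sub>R axis i 1)"
      by (simp add: vec_eq_iff axis_def if_distrib cong: if_cong)
    then have "?D h = ?D (\<Sum>i\<in>UNIV. h $ i *\<^sub>R axis i 1)" by simp
    then show ?thesis by (simp add: sum scaleR partial_def)
  qed
  then have "?D = (\<lambda>h. \<Sum>i\<in>UNIV. h $ i *\<^sub>R partial i f x)" by (rule ext)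
  with D show ?thesis by simp
qed

lemma sum_axis_scaleR:
  fixes g :: "'n::finite \<Rightarrow> 'a::real_vector"
  shows "(\<Sum>j\<in>UNIV. (c * axis i 1 $ j) *\<^sub>R g j) = c *\<^sub>R g i"
proof -
  have "(\<Sum>j\<in>UNIV. (c * axis i 1 $ j) *\<^sub>R g j) = (\<Sum>j\<in>UNIV. if j = i then c *\<^sub>R g j else 0)"
    by (intro sum.cong) (auto simp: axis_def)
  then show ?thesis by simp
qed

lemma has_vector_derivative_partial_line:
  assumes "f differentiable at (x + t *\<^sub>R axis i 1)"
  shows "((\<lambda>t. f (x + t *\<^sub>R axis i 1)) has_vector_derivative
    partial i f (x + t *\<^sub>R axis i 1)) (at t)"
proof -
  have "((\<lambda>t. x + t *\<^sub>R axis i 1) has_derivative (\<lambda>s. s *\<^sub>R axis i 1)) (at t)"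
    by (auto intro!: derivative_eq_intros)
  from has_derivative_compose[OF this has_derivative_partial[OF assms]] show ?thesis
    by (simp add: has_vector_derivative_def sum_axis_scaleR)
qed

text \<open>The chain rule for both sides of \<open>eq\<close>. Scalings use multiples of the
  identity for \<open>L\<close> and \<open>A\<close>, rotations use \<open>L = rot \<alpha>\<close>.
  Openness of \<open>S\<close> allows the identity, known only in the half space, to be
  differentiated.\<close>

lemma partial_intertwined:
  assumes "open S" and x: "x \<in> S" and f: "f differentiable at (L x)" and g: "g differentiable at x"
    and L: "bounded_linear L" and A: "bounded_linear A"
    and eq: "\<And>y. y \<in> S \<Longrightarrow> f (L y) = A (g y)"
  shows "(\<Sum>j\<in>UNIV. L h $ j *\<^sub>R partial j f (L x)) = A (\<Sum>i\<in>UNIV. h $ i *\<^sub>R partial i g x)"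
proof -
  have "((\<lambda>y. f (L y)) has_derivative (\<lambda>h. \<Sum>j\<in>UNIV. L h $ j *\<^sub>R partial j f (L x))) (at x)"
    using has_derivative_compose[OF bounded_linear_imp_has_derivative[OF L] has_derivative_partial[OF f]] .
  moreover have "((\<lambda>y. A (g y)) has_derivative (\<lambda>h. A (\<Sum>i\<in>UNIV. h $ i *\<^sub>R partial i g x))) (at x)"
    using has_derivative_compose[OF has_derivative_partial[OF g] bounded_linear_imp_has_derivative[OF A]] .
  then have "((\<lambda>y. f (L y)) has_derivative (\<lambda>h. A (\<Sum>i\<in>UNIV. h $ i *\<^sub>R partial i g x))) (at x)"
    by (rule has_derivative_transform_within_open[OF _ \<open>open S\<close> x]) (simp add: eq)
  ultimately show ?thesis
    by (rule fun_cong[OF has_derivative_unique])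
qed

lemma partial_lincomb:
  assumes "f differentiable at x" "g differentiable at x"
  shows "partial i (\<lambda>y. a *\<^sub>R f y + b *\<^sub>R g y) x = a *\<^sub>R partial i f x + b *\<^sub>R partial i g x"
proof -
  have "((\<lambda>y. a *\<^sub>R f y + b *\<^sub>R g y) has_derivative
      (\<lambda>h. a *\<^sub>R frechet_derivative f (at x) h + b *\<^sub>R frechet_derivative g (at x) h)) (at x)"
    using assms frechet_derivative_works by (intro derivative_intros) blast+
  from fun_cong[OF frechet_derivative_at[OF this], of "axis i 1"] show ?thesis
    by (simp add: partial_def)
qed

section \<open>Scaling and the Euler relation\<close>

lemma open_half_space: "open half_space"
  unfolding half_space_def by (intro open_Collect_less continuous_intros)

lemma scaleR_half_space: "x \<in> half_space \<Longrightarrow> c > 0 \<Longrightarrow> c *\<^sub>R x \<in> half_space"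
  by (simp add: half_space_def)

lemma partial_homogeneous:
  assumes f: "\<And>x. x \<in> half_space \<Longrightarrow> f differentiable at x"
    and hom: "\<And>x c. x \<in> half_space \<Longrightarrow> c > 0 \<Longrightarrow> f (c *\<^sub>R x) = inverse c ^ k *\<^sub>R f x"
    and x: "x \<in> half_space" and "c > 0"
  shows "partial i f (c *\<^sub>R x) = inverse c ^ Suc k *\<^sub>R partial i f x"
proof -
  have "(\<Sum>j\<in>UNIV. (c *\<^sub>R axis i 1) $ j *\<^sub>R partial j f (c *\<^sub>R x))
      = inverse c ^ k *\<^sub>R (\<Sum>j\<in>UNIV. axis i 1 $ j *\<^sub>R partial j f x)"
    by (rule partial_intertwined[OF open_half_space])
      (use assms scaleR_half_space in \<open>auto intro: bounded_linear_scaleR_right\<close>)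
  then have "c *\<^sub>R partial i f (c *\<^sub>R x) = inverse c ^ k *\<^sub>R partial i f x"
    by (simp add: sum_axis_scaleR sum_axis_scaleR[where c = 1, simplified])
  then have "inverse c *\<^sub>R c *\<^sub>R partial i f (c *\<^sub>R x) = inverse c *\<^sub>R inverse c ^ k *\<^sub>R partial i f x"
    by simp
  then show ?thesis using \<open>c > 0\<close> by simp
qed

text \<open>Differentiate the homogeneity relation in \<open>c\<close> at 1. It is applied with k =
  1 to \<open>u\<close> and with k = 2 to its first partial derivatives.\<close>

lemma Euler_relation:
  assumes f: "f differentiable at x"
    and hom: "\<And>c. c > 0 \<Longrightarrow> f (c *\<^sub>R x) = inverse c ^ k *\<^sub>R f x"
  shows "x $ 1 *\<^sub>R partial 1 f x + x $ 2 *\<^sub>R partial 2 f x + x $ 3 *\<^sub>R partial 3 f x = - real k *\<^sub>R f x"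
proof -
  have "((\<lambda>c. c *\<^sub>R x) has_derivative (\<lambda>s. s *\<^sub>R x)) (at 1)"
    by (auto intro!: derivative_eq_intros)
  from has_derivative_compose[OF this, of f "\<lambda>h. \<Sum>i\<in>UNIV. h $ i *\<^sub>R partial i f x"]
  have "((\<lambda>c. f (c *\<^sub>R x)) has_vector_derivative (\<Sum>i\<in>UNIV. x $ i *\<^sub>R partial i f x)) (at 1)"
    using has_derivative_partial[OF f] by (simp add: has_vector_derivative_def scaleR_sum_right)
  moreover have "((\<lambda>c. inverse c ^ k *\<^sub>R f x) has_vector_derivative - real k *\<^sub>R f x) (at 1)"
    by (rule derivative_eq_intros refl | simp)+
  then have "((\<lambda>c. f (c *\<^sub>R x)) has_vector_derivative - real k *\<^sub>R f x) (at 1)"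
    by (rule has_vector_derivative_transform_within_open[of _ _ _ "{0<..}"]) (auto simp: hom)
  ultimately show ?thesis
    using vector_derivative_unique_at by (fastforce simp: sum_3)
qed

section \<open>Rotations about the third axis\<close>

definition rot :: "real \<Rightarrow> real^3 \<Rightarrow> real^3"
  where "rot \<alpha> x = vector [cos \<alpha> * x $ 1 - sin \<alpha> * x $ 2, sin \<alpha> * x $ 1 + cos \<alpha> * x $ 2, x $ 3]"

text \<open>The infinitesimal generator of the rotations \<open>rot \<alpha>\<close>.\<close>

definition quarter_turn :: "real^3 \<Rightarrow> real^3"
  where "quarter_turn x = vector [- x $ 2, x $ 1, 0]"

lemma vec3_eq_iff: "x = (y :: 'a^3) \<longleftrightarrow> x $ 1 = y $ 1 \<and> x $ 2 = y $ 2 \<and> x $ 3 = y $ 3"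
  by (auto simp: vec_eq_iff forall_3)

lemma rot_nth [simp]:
  "rot \<alpha> x $ 1 = cos \<alpha> * x $ 1 - sin \<alpha> * x $ 2"
  "rot \<alpha> x $ 2 = sin \<alpha> * x $ 1 + cos \<alpha> * x $ 2"
  "rot \<alpha> x $ 3 = x $ 3"
  by (simp_all add: rot_def)

lemma quarter_turn_nth [simp]:
  "quarter_turn x $ 1 = - x $ 2" "quarter_turn x $ 2 = x $ 1" "quarter_turn x $ 3 = 0"
  by (simp_all add: quarter_turn_def)

lemma bounded_linear_rot: "bounded_linear (rot \<alpha>)"
  unfolding linear_conv_bounded_linear[symmetric]
  by (intro linearI) (auto simp: vec3_eq_iff algebra_simps)

lemma bounded_linear_quarter_turn: "bounded_linear quarter_turn"
  unfolding linear_conv_bounded_linear[symmetric]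
  by (intro linearI) (auto simp: vec3_eq_iff algebra_simps)

lemma rot_half_space: "x \<in> half_space \<Longrightarrow> rot \<alpha> x \<in> half_space"
  by (simp add: half_space_def)

lemma has_vector_derivative_rot:
  "((\<lambda>\<alpha>. rot \<alpha> x) has_vector_derivative quarter_turn (rot \<alpha> x)) (at \<alpha>)"
proof -
  define a b c :: "real^3"
    where "a = vector [x $ 1, x $ 2, 0]" and "b = vector [- x $ 2, x $ 1, 0]" and "c = vector [0, 0, x $ 3]"
  have "((\<lambda>\<alpha>. cos \<alpha> *\<^sub>R a + sin \<alpha> *\<^sub>R b + c) has_vector_derivative - sin \<alpha> *\<^sub>R a + cos \<alpha> *\<^sub>R b) (at \<alpha>)"
    by (rule derivative_eq_intros refl | simp)+
  moreover have "rot \<alpha> x = cos \<alpha> *\<^sub>R a + sin \<alpha> *\<^sub>R b + c" for \<alpha>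
    by (simp add: vec3_eq_iff a_def b_def c_def)
  moreover have "quarter_turn (rot \<alpha> x) = - sin \<alpha> *\<^sub>R a + cos \<alpha> *\<^sub>R b"
    by (simp add: vec3_eq_iff a_def b_def c_def)
  ultimately show ?thesis by simp
qed

text \<open>The direction that \<open>rot \<alpha>\<close> carries to a coordinate axis turns the
  chain rule into a formula for a single partial derivative. Allowing \<open>f\<close> and
  \<open>g\<close> to differ lets the lemma be iterated for second derivatives.\<close>

lemma partial_rotated:
  assumes x: "x \<in> half_space" and f: "f differentiable at (rot \<alpha> x)" and g: "g differentiable at x"
    and A: "bounded_linear A" and eq: "\<And>y. y \<in> half_space \<Longrightarrow> f (rot \<alpha> y) = A (g y)"
  shows "partial 1 f (rot \<alpha> x) = A (cos \<alpha> *\<^sub>R partial 1 g x - sin \<alpha> *\<^sub>R partial 2 g x)"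
    and "partial 2 f (rot \<alpha> x) = A (sin \<alpha> *\<^sub>R partial 1 g x + cos \<alpha> *\<^sub>R partial 2 g x)"
    and "partial 3 f (rot \<alpha> x) = A (partial 3 g x)"
proof -
  interpret A: bounded_linear A by (rule A)
  have D: "(\<Sum>j\<in>UNIV. rot \<alpha> h $ j *\<^sub>R partial j f (rot \<alpha> x))
      = A (\<Sum>i\<in>UNIV. h $ i *\<^sub>R partial i g x)" for h
    by (rule partial_intertwined[OF open_half_space x f g bounded_linear_rot A eq])
  have D: "rot \<alpha> (vector [a, b, c]) $ 1 *\<^sub>R partial 1 f (rot \<alpha> x)
      + rot \<alpha> (vector [a, b, c]) $ 2 *\<^sub>R partial 2 f (rot \<alpha> x) + c *\<^sub>R partial 3 f (rot \<alpha> x)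
      = A (a *\<^sub>R partial 1 g x + b *\<^sub>R partial 2 g x + c *\<^sub>R partial 3 g x)" for a b c
    using D[of "vector [a, b, c]"] by (simp add: sum_3)
  have [simp]: "cos \<alpha> * cos \<alpha> + sin \<alpha> * sin \<alpha> = 1" "sin \<alpha> * sin \<alpha> + cos \<alpha> * cos \<alpha> = 1"
    using sin_cos_squared_add3[of \<alpha>] by (simp_all add: add.commute)
  show "partial 1 f (rot \<alpha> x) = A (cos \<alpha> *\<^sub>R partial 1 g x - sin \<alpha> *\<^sub>R partial 2 g x)"
    using D[of "cos \<alpha>" "- sin \<alpha>" 0] by (simp add: mult.commute)
  show "partial 2 f (rot \<alpha> x) = A (sin \<alpha> *\<^sub>R partial 1 g x + cos \<alpha> *\<^sub>R partial 2 g x)"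
    using D[of "sin \<alpha>" "cos \<alpha>" 0] by (simp add: mult.commute)
  show "partial 3 f (rot \<alpha> x) = A (partial 3 g x)"
    using D[of 0 0 1] by simp
qed

section \<open>From spherical components to equivariance under rotations\<close>

lemma spherical_coordinates:
  assumes "x $ 3 > 0" and "x $ 1 \<noteq> 0 \<or> x $ 2 \<noteq> 0"
  obtains \<rho> \<phi> \<theta> where "\<rho> > 0" "0 < \<phi>" "\<phi> < pi / 2" "x = \<rho> *\<^sub>R e_rho \<theta> \<phi>"
proof -
  define r where "r = sqrt ((x $ 1)\<^sup>2 + (x $ 2)\<^sup>2)"
  have r: "r > 0"
    using assms(2) by (auto simp: r_def sum_power2_gt_zero_iff)
  have r2: "r\<^sup>2 = (x $ 1)\<^sup>2 + (x $ 2)\<^sup>2" by (simp add: r_def)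
  have "(x $ 1 / r)\<^sup>2 + (x $ 2 / r)\<^sup>2 = 1"
    using r by (simp add: power_divide add_divide_distrib[symmetric] r2[symmetric])
  then obtain \<theta> where \<theta>: "x $ 1 / r = cos \<theta>" "x $ 2 / r = sin \<theta>"
    using sincos_total_2pi by metis
  define \<rho> where "\<rho> = sqrt (r\<^sup>2 + (x $ 3)\<^sup>2)"
  define \<phi> where "\<phi> = arctan (r / x $ 3)"
  have \<phi>: "0 < \<phi>" "\<phi> < pi / 2"
    using r assms(1) arctan_ubound by (auto simp: \<phi>_def)
  have sq: "sqrt (1 + (r / x $ 3)\<^sup>2) = \<rho> / x $ 3"
  proof -
    have "1 + (r / x $ 3)\<^sup>2 = (r\<^sup>2 + (x $ 3)\<^sup>2) / (x $ 3)\<^sup>2"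
      using assms(1) by (simp add: field_simps)
    then show ?thesis using assms(1) by (simp add: \<rho>_def real_sqrt_divide)
  qed
  have \<rho>: "\<rho> > 0" using r by (simp add: \<rho>_def add_pos_nonneg)
  have "\<rho> * cos \<phi> = x $ 3" "\<rho> * sin \<phi> = r"
    using sq \<rho> assms(1) by (simp_all add: \<phi>_def cos_arctan sin_arctan)
  then have "x = \<rho> *\<^sub>R e_rho \<theta> \<phi>"
    using r \<theta> by (simp add: vec3_eq_iff e_rho_def mult.assoc[symmetric] field_simps)
  then show ?thesis using that \<phi> \<rho> by blast
qed

lemma rot_e_rho: "rot \<alpha> (\<rho> *\<^sub>R e_rho \<theta> \<phi>) = \<rho> *\<^sub>R e_rho (\<theta> + \<alpha>) \<phi>"
  by (simp add: vec3_eq_iff e_rho_def cos_add sin_add algebra_simps)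

text \<open>The orthonormal frame at \<theta> + \<alpha> is the image under
  \<open>rot \<alpha>\<close> of the frame at \<theta>, so equal components mean rotated
  vectors.\<close>

lemma eq_rot_from_frame:
  assumes "w \<bullet> e_rho \<theta> \<phi> = w' \<bullet> e_rho (\<theta> + \<alpha>) \<phi>" "w \<bullet> e_phi \<theta> \<phi> = w' \<bullet> e_phi (\<theta> + \<alpha>) \<phi>"
    "w \<bullet> e_theta \<theta> = w' \<bullet> e_theta (\<theta> + \<alpha>)"
  shows "w' = rot \<alpha> w"
proof -
  have sc: "cos t * cos t = 1 - sin t * sin t" for t :: real
    using sin_cos_squared_add3[of t] by linarith
  define C S where "C = cos (\<theta> + \<alpha>)" and "S = sin (\<theta> + \<alpha>)"
  note inner3 = inner_vec_def sum_3 e_rho_def e_phi_def e_theta_def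
  have CS: "C * C = 1 - S * S" using sc by (simp add: C_def S_def)
  have a: "w $ 1 * (sin \<phi> * cos \<theta>) + w $ 2 * (sin \<phi> * sin \<theta>) + w $ 3 * cos \<phi>
      = w' $ 1 * (sin \<phi> * C) + w' $ 2 * (sin \<phi> * S) + w' $ 3 * cos \<phi>"
    using assms(1) by (simp add: inner3 C_def S_def)
  have b: "w $ 1 * (cos \<phi> * cos \<theta>) + w $ 2 * (cos \<phi> * sin \<theta>) - w $ 3 * sin \<phi>
      = w' $ 1 * (cos \<phi> * C) + w' $ 2 * (cos \<phi> * S) - w' $ 3 * sin \<phi>"
    using assms(2) by (simp add: inner3 C_def S_def)
  have c: "- w $ 1 * sin \<theta> + w $ 2 * cos \<theta> = - w' $ 1 * S + w' $ 2 * C"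
    using assms(3) by (simp add: inner3 C_def S_def)
  \<comment> \<open>The e_rho and e_phi components are an orthogonal transform of the horizontal
    radial and the vertical component; inverting it gives \<open>d\<close> and
    \<open>e\<close>.\<close>
  have d: "w $ 1 * cos \<theta> + w $ 2 * sin \<theta> = w' $ 1 * C + w' $ 2 * S"
    using a b sc[of \<phi>] by algebra
  have e: "w $ 3 = w' $ 3"
    using a b sc[of \<phi>] by algebra
  have ca: "cos \<alpha> = C * cos \<theta> + S * sin \<theta>" "sin \<alpha> = S * cos \<theta> - C * sin \<theta>"
    using cos_diff[of "\<theta> + \<alpha>" \<theta>] sin_diff[of "\<theta> + \<alpha>" \<theta>] by (simp_all add: C_def S_def)
  have "w' $ 1 = cos \<alpha> * w $ 1 - sin \<alpha> * w $ 2"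
    unfolding ca using c d CS by algebra
  moreover have "w' $ 2 = sin \<alpha> * w $ 1 + cos \<alpha> * w $ 2"
    unfolding ca using c d CS by algebra
  ultimately show ?thesis using e by (simp add: vec3_eq_iff)
qed

lemma axially_symmetric_rot:
  assumes sym: "axially_symmetric u" and cont: "continuous_on half_space u" and x: "x \<in> half_space"
  shows "u (rot \<alpha> x) = rot \<alpha> (u x)"
proof -
  have off: "u (rot \<alpha> y) = rot \<alpha> (u y)" if y: "y \<in> half_space" "y $ 1 \<noteq> 0 \<or> y $ 2 \<noteq> 0" for y
  proof -
    obtain \<rho> \<phi> \<theta> where *: "\<rho> > 0" "0 < \<phi>" "\<phi> < pi / 2" and y_eq: "y = \<rho> *\<^sub>R e_rho \<theta> \<phi>"
      using spherical_coordinates[of y] y unfolding half_space_def by blast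
    note frame = sym[unfolded axially_symmetric_def, rule_format, OF *, of \<theta> "\<theta> + \<alpha>"]
    show ?thesis
      unfolding y_eq rot_e_rho
      by (rule eq_rot_from_frame[OF frame[THEN conjunct1] frame[THEN conjunct2, THEN conjunct1]
            frame[THEN conjunct2, THEN conjunct2]])
  qed
  show ?thesis
  proof (cases "x $ 1 \<noteq> 0 \<or> x $ 2 \<noteq> 0")
    case False
    \<comment> \<open>The frame is undefined on the axis, so the relation is carried there by
      continuity along points off the axis.\<close>
    define y where "y t = x + t *\<^sub>R axis 1 1" for t :: real
    have y: "y t \<in> half_space" "t \<noteq> 0 \<Longrightarrow> y t $ 1 \<noteq> 0" for t
      using x False by (auto simp: y_def half_space_def axis_def)
    have isCont_u: "isCont u z" if "z \<in> half_space" for z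
      using cont that open_half_space continuous_on_eq_continuous_at by blast
    have lim: "(y \<longlongrightarrow> x) (at 0)"
      unfolding y_def by (rule tendsto_eq_intros refl | simp)+
    have "((\<lambda>t. rot \<alpha> (u (y t))) \<longlongrightarrow> rot \<alpha> (u x)) (at 0)"
      by (rule bounded_linear.tendsto[OF bounded_linear_rot isCont_tendsto_compose[OF isCont_u[OF x] lim]])
    moreover have "\<forall>\<^sub>F t in at 0. rot \<alpha> (u (y t)) = u (rot \<alpha> (y t))"
      using eventually_neq_at_within[of 0 0 UNIV] by eventually_elim (simp add: off y)
    ultimately have "((\<lambda>t. u (rot \<alpha> (y t))) \<longlongrightarrow> rot \<alpha> (u x)) (at 0)"
      by (rule Lim_transform_eventually)
    moreover have "((\<lambda>t. u (rot \<alpha> (y t))) \<longlongrightarrow> u (rot \<alpha> x)) (at 0)"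
      by (rule isCont_tendsto_compose[OF isCont_u[OF rot_half_space[OF x]]
            bounded_linear.tendsto[OF bounded_linear_rot lim]])
    ultimately show ?thesis
      using tendsto_unique[OF at_neq_bot] by blast
  qed (use off x in auto)
qed

section \<open>Reduction to the profile\<close>

text \<open>Symmetry is stated as equivariance, which also covers the axis and can be
  differentiated. The equation is solved for \<open>gradient p\<close> because the pressure gradient
  must inherit its symmetries from \<open>u\<close>.\<close>

locale axisymmetric_flow =
  fixes u :: "real^3 \<Rightarrow> real^3" and p :: "real^3 \<Rightarrow> real"
  assumes diff_u: "x \<in> half_space \<Longrightarrow> u differentiable at x"
    and diff_partial_u: "x \<in> half_space \<Longrightarrow> partial i u differentiable at x"
    and diff_p: "x \<in> half_space \<Longrightarrow> p differentiable at x"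
    and momentum: "x \<in> half_space \<Longrightarrow> gradient p x = laplacian u x - convection u u x"
    and divergence_free: "x \<in> half_space \<Longrightarrow> divergence u x = 0"
    and homogeneous: "x \<in> half_space \<Longrightarrow> c > 0 \<Longrightarrow> u (c *\<^sub>R x) = inverse c *\<^sub>R u x"
    and symmetric: "x \<in> half_space \<Longrightarrow> u (rot \<alpha> x) = rot \<alpha> (u x)"
begin

section \<open>Scaling and rotation of the pressure gradient\<close>

lemma partial_u_scale:
  assumes "x \<in> half_space" "c > 0"
  shows "partial i u (c *\<^sub>R x) = inverse c ^ 2 *\<^sub>R partial i u x"
  using partial_homogeneous[of u 1 x c i] diff_u homogeneous assms by (simp add: numeral_2_eq_2)

lemma partial_partial_u_scale:
  assumes "x \<in> half_space" "c > 0"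
  shows "partial j (partial i u) (c *\<^sub>R x) = inverse c ^ 3 *\<^sub>R partial j (partial i u) x"
  using partial_homogeneous[of "partial i u" 2 x c j] diff_partial_u partial_u_scale assms
  by (simp add: numeral_3_eq_3 numeral_2_eq_2)

lemma gradient_p_scale:
  assumes x: "x \<in> half_space" and c: "c > 0"
  shows "gradient p (c *\<^sub>R x) = inverse c ^ 3 *\<^sub>R gradient p x"
proof -
  have "laplacian u (c *\<^sub>R x) = inverse c ^ 3 *\<^sub>R laplacian u x"
    by (simp add: laplacian_def partial_partial_u_scale[OF x c] scaleR_sum_right)
  moreover have "convection u u (c *\<^sub>R x) = inverse c ^ 3 *\<^sub>R convection u u x"
    by (simp add: convection_def partial_u_scale[OF x c] homogeneous[OF x c] scaleR_sum_right
        power2_eq_square power3_eq_cube mult_ac)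
  ultimately show ?thesis
    using x c by (simp add: momentum scaleR_half_space scaleR_right_diff_distrib)
qed

lemma gradient_p_rot:
  assumes x: "x \<in> half_space"
  shows "gradient p (rot \<alpha> x) = rot \<alpha> (gradient p x)"
proof -
  interpret R: bounded_linear "rot \<alpha>" by (rule bounded_linear_rot)
  define C S where "C = cos \<alpha>" and "S = sin \<alpha>"
  have CS: "C * C = 1 - S * S"
    using sin_cos_squared_add3[of \<alpha>] unfolding C_def S_def by linarith
  \<comment> \<open>\<open>g1\<close> and \<open>g2\<close> are the derivatives of \<open>u\<close>
    in the directions that \<open>rot \<alpha>\<close> carries to the first and second axis.\<close>
  define g1 where "g1 y = C *\<^sub>R partial 1 u y + (- S) *\<^sub>R partial 2 u y" for y
  define g2 where "g2 y = S *\<^sub>R partial 1 u y + C *\<^sub>R partial 2 u y" for y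
  have rotx: "rot \<alpha> y \<in> half_space" if "y \<in> half_space" for y
    using that by (rule rot_half_space)
  note first = partial_rotated[OF _ diff_u[OF rotx] diff_u bounded_linear_rot symmetric]
  have d1: "partial 1 u (rot \<alpha> y) = rot \<alpha> (g1 y)" if "y \<in> half_space" for y
    using first(1)[OF that that that] by (simp add: g1_def C_def S_def)
  have d2: "partial 2 u (rot \<alpha> y) = rot \<alpha> (g2 y)" if "y \<in> half_space" for y
    using first(2)[OF that that that] by (simp add: g2_def C_def S_def)
  have d3: "partial 3 u (rot \<alpha> y) = rot \<alpha> (partial 3 u y)" if "y \<in> half_space" for y
    using first(3)[OF that that that] .
  have diff_g: "g1 differentiable at x" "g2 differentiable at x"
    unfolding g1_def g2_def by (intro derivative_intros diff_partial_u x)+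
  have "partial 1 (partial 1 u) (rot \<alpha> x) = rot \<alpha> (C *\<^sub>R partial 1 g1 x - S *\<^sub>R partial 2 g1 x)"
    using partial_rotated(1)[OF x diff_partial_u[OF rotx[OF x]] diff_g(1) bounded_linear_rot d1]
    by (simp add: C_def S_def)
  moreover have "partial 2 (partial 2 u) (rot \<alpha> x) = rot \<alpha> (S *\<^sub>R partial 1 g2 x + C *\<^sub>R partial 2 g2 x)"
    using partial_rotated(2)[OF x diff_partial_u[OF rotx[OF x]] diff_g(2) bounded_linear_rot d2]
    by (simp add: C_def S_def)
  moreover have "partial 3 (partial 3 u) (rot \<alpha> x) = rot \<alpha> (partial 3 (partial 3 u) x)"
    by (rule partial_rotated(3)[OF x diff_partial_u[OF rotx[OF x]] diff_partial_u[OF x]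
          bounded_linear_rot d3])
  moreover have "partial i g1 x = C *\<^sub>R partial i (partial 1 u) x + (- S) *\<^sub>R partial i (partial 2 u) x" for i
    unfolding g1_def by (intro partial_lincomb diff_partial_u x)
  moreover have "partial i g2 x = S *\<^sub>R partial i (partial 1 u) x + C *\<^sub>R partial i (partial 2 u) x" for i
    unfolding g2_def by (intro partial_lincomb diff_partial_u x)
  \<comment> \<open>Here \<open>a\<close> and \<open>d\<close> are the pure second derivatives,
    \<open>b\<close> and \<open>c\<close> the mixed ones. The contributions of \<open>b\<close> and
    of \<open>c\<close> each sum to 0.\<close>
  moreover have "C *\<^sub>R (C *\<^sub>R a + (- S) *\<^sub>R b) - S *\<^sub>R (C *\<^sub>R c + (- S) *\<^sub>R d)
      + (S *\<^sub>R (S *\<^sub>R a + C *\<^sub>R b) + C *\<^sub>R (S *\<^sub>R c + C *\<^sub>R d)) = a + d" for a b c d :: "real^3"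
  proof -
    have "C * (C * a + (- S) * b) - S * (C * c + (- S) * d)
      + (S * (S * a + C * b) + C * (S * c + C * d)) = a + d" for a b c d
      using CS by algebra
    then show ?thesis by (simp add: vec_eq_iff)
  qed
  ultimately have "laplacian u (rot \<alpha> x) = rot \<alpha> (laplacian u x)"
    unfolding laplacian_def sum_3 by (simp only: R.add[symmetric])
  moreover have "convection u u (rot \<alpha> x) = rot \<alpha> (convection u u x)"
  proof -
    have "(C * v - S * w) *\<^sub>R (C *\<^sub>R a + (- S) *\<^sub>R b) + (S * v + C * w) *\<^sub>R (S *\<^sub>R a + C *\<^sub>R b)
        = v *\<^sub>R a + w *\<^sub>R b" for v w and a b :: "real^3"
    proof -
      have "(C * v - S * w) * (C * a + (- S) * b) + (S * v + C * w) * (S * a + C * b)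
        = v * a + w * b" for a b
        using CS by algebra
      then show ?thesis by (simp add: vec_eq_iff)
    qed
    then show ?thesis
      unfolding convection_def sum_3 symmetric[OF x] d1[OF x] d2[OF x] d3[OF x]
        rot_nth C_def[symmetric] S_def[symmetric] g1_def g2_def
      by (simp only: R.add[symmetric] R.scaleR[symmetric])
  qed
  ultimately show ?thesis
    using x rotx[OF x] by (simp add: momentum R.diff)
qed

text \<open>Equivariance of the gradient makes the angular derivative of \<open>p\<close> constant
  along a circle. As \<open>p\<close> returns to its value after a full turn, that constant is
  0.\<close>

lemma angular_pressure_gradient:
  assumes x: "x \<in> half_space"
  shows "x $ 1 * partial 2 p x = x $ 2 * partial 1 p x"
proof -
  define k where "k = x $ 1 * partial 2 p x - x $ 2 * partial 1 p x"
  have deriv: "((\<lambda>\<alpha>. p (rot \<alpha> x)) has_real_derivative k) (at \<alpha>)" for \<alpha>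
  proof -
    have "((\<lambda>\<alpha>. p (rot \<alpha> x)) has_vector_derivative
        (\<Sum>i\<in>UNIV. quarter_turn (rot \<alpha> x) $ i *\<^sub>R partial i p (rot \<alpha> x))) (at \<alpha>)"
      using has_derivative_compose[OF has_vector_derivative_rot[unfolded has_vector_derivative_def]
          has_derivative_partial[OF diff_p[OF rot_half_space[OF x]]]]
      by (simp add: has_vector_derivative_def scaleR_sum_right mult.assoc sum_distrib_left)
    moreover have "partial i p (rot \<alpha> x) = rot \<alpha> (gradient p x) $ i" for i
      using gradient_p_rot[OF x] by (simp add: gradient_def vec_eq_iff)
    moreover have "cos \<alpha> * cos \<alpha> = 1 - sin \<alpha> * sin \<alpha>"
      using sin_cos_squared_add3[of \<alpha>] by linarith
    then have "(\<Sum>i\<in>UNIV. quarter_turn (rot \<alpha> x) $ i *\<^sub>R rot \<alpha> (gradient p x) $ i) = k"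
      by (simp add: sum_3 k_def gradient_def) algebra
    ultimately show ?thesis by (simp add: has_real_derivative_iff_has_vector_derivative)
  qed
  have "((\<lambda>\<alpha>. p (rot \<alpha> x) - k * \<alpha>) has_real_derivative 0) (at \<alpha>)" for \<alpha>
    by (rule derivative_eq_intros deriv refl | simp)+
  then have "p (rot (2 * pi) x) - k * (2 * pi) = p (rot 0 x) - k * 0"
    by (intro DERIV_isconst_all) blast
  moreover have "rot (2 * pi) x = rot 0 x" by (simp add: vec3_eq_iff)
  ultimately show ?thesis by (simp add: k_def)
qed

text \<open>The parameter is the cotangent of the polar angle: z = 0 lies on the boundary, and large
  z approaches the direction of the axis. Scalings and rotations carry this half line to every point
  of the half space off the axis.\<close>

definition pt :: "real \<Rightarrow> real^3"
  where "pt z = vector [1, 0, z]"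

lemma pt_nth [simp]: "pt z $ 1 = 1" "pt z $ 2 = 0" "pt z $ 3 = z"
  by (simp_all add: pt_def)

lemma pt_half_space: "z > 0 \<Longrightarrow> pt z \<in> half_space"
  by (simp add: half_space_def)

lemma has_vector_derivative_pt:
  assumes "f differentiable at (pt z)"
  shows "((\<lambda>z. f (pt z)) has_vector_derivative partial 3 f (pt z)) (at z)"
proof -
  have "pt 0 + z *\<^sub>R axis 3 1 = pt z" for z
    by (simp add: vec3_eq_iff axis_def)
  then show ?thesis
    using has_vector_derivative_partial_line[of f "pt 0" z 3] assms by simp
qed

text \<open>A gradient of degree -3 makes \<open>p\<close> homogeneous of degree -2 up to an
  additive constant, and \<open>k\<close> is twice that constant.\<close>

lemma pressure_on_line:
  obtains k where "\<And>z. z > 0 \<Longrightarrow> partial 1 p (pt z) = k - 2 * p (pt z) - z * partial 3 p (pt z)"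
proof -
  \<comment> \<open>The defect of \<open>p\<close> from degree -2 has derivative 0 along the line,
    so it depends on \<open>c\<close> alone. Its derivative in \<open>c\<close> at 1 is
    \<open>k\<close>.\<close>
  have const: "p (c *\<^sub>R pt z) - inverse c ^ 2 * p (pt z) = p (c *\<^sub>R pt 1) - inverse c ^ 2 * p (pt 1)"
    if c: "c > 0" and z: "z > 0" for c z
  proof -
    have "((\<lambda>z. p (c *\<^sub>R pt z) - inverse c ^ 2 * p (pt z)) has_real_derivative 0) (at z)"
      if z: "z > 0" for z
    proof -
      have "((\<lambda>z. p (pt z)) has_real_derivative partial 3 p (pt z)) (at z)"
        using has_vector_derivative_pt[OF diff_p[OF pt_half_space[OF z]]]
        by (simp add: has_real_derivative_iff_has_vector_derivative)
      moreover have "((\<lambda>z. p (c *\<^sub>R pt z)) has_real_derivative c * partial 3 p (c *\<^sub>R pt z)) (at z)"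
      proof -
        define P where "P t = p (c *\<^sub>R pt 0 + t *\<^sub>R axis 3 1)" for t
        have eq: "c *\<^sub>R pt z = c *\<^sub>R pt 0 + (c * z) *\<^sub>R axis 3 1" for z
          by (simp add: vec3_eq_iff axis_def)
        have "(P has_real_derivative partial 3 p (c *\<^sub>R pt z)) (at (c * z))"
          using has_vector_derivative_partial_line[of p "c *\<^sub>R pt 0" "c * z" 3, folded eq P_def]
            diff_p[OF scaleR_half_space[OF pt_half_space[OF z] c]]
          by (simp only: has_real_derivative_iff_has_vector_derivative)
        from DERIV_chain2[OF this DERIV_cmult[OF DERIV_ident]]
        have "((\<lambda>z. P (c * z)) has_real_derivative c * partial 3 p (c *\<^sub>R pt z)) (at z)"
          by (simp add: mult.commute)
        moreover have "P (c * z) = p (c *\<^sub>R pt z)" for z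
          unfolding P_def eq[of z] ..
        ultimately show ?thesis by simp
      qed
      moreover have "partial 3 p (c *\<^sub>R pt z) = inverse c ^ 3 * partial 3 p (pt z)"
        using gradient_p_scale[OF pt_half_space[OF z] c] by (simp add: gradient_def vec_eq_iff)
      ultimately show ?thesis
        using c by (auto intro!: derivative_eq_intros simp: power2_eq_square power3_eq_cube)
    qed
    from constant_on_pos[OF this] show ?thesis using z by (metis zero_less_one)
  qed
  have deriv: "((\<lambda>c. p (c *\<^sub>R pt z) - inverse c ^ 2 * p (pt z)) has_real_derivative
      partial 1 p (pt z) + z * partial 3 p (pt z) + 2 * p (pt z)) (at 1)" if z: "z > 0" for z
  proof -
    have "((\<lambda>c. c *\<^sub>R pt z) has_derivative (\<lambda>s. s *\<^sub>R pt z)) (at 1)"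
      by (auto intro!: derivative_eq_intros)
    from has_derivative_compose[OF this, of p "\<lambda>h. \<Sum>i\<in>UNIV. h $ i *\<^sub>R partial i p (pt z)"]
    have "((\<lambda>c. p (c *\<^sub>R pt z)) has_derivative
        (\<lambda>s. \<Sum>i\<in>UNIV. (s *\<^sub>R pt z) $ i *\<^sub>R partial i p (pt z))) (at 1)"
      using has_derivative_partial[OF diff_p[OF pt_half_space[OF z]]] by simp
    moreover have "(\<lambda>s. \<Sum>i\<in>UNIV. (s *\<^sub>R pt z) $ i *\<^sub>R partial i p (pt z))
        = (\<lambda>s. (partial 1 p (pt z) + z * partial 3 p (pt z)) * s)"
      by (simp add: fun_eq_iff sum_3 algebra_simps)
    ultimately have "((\<lambda>c. p (c *\<^sub>R pt z)) has_real_derivative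
        partial 1 p (pt z) + z * partial 3 p (pt z)) (at 1)"
      by (simp only: has_field_derivative_def)
    then show ?thesis
      by (auto intro!: derivative_eq_intros)
  qed
  have "partial 1 p (pt z) + z * partial 3 p (pt z) + 2 * p (pt z)
      = partial 1 p (pt 1) + 1 * partial 3 p (pt 1) + 2 * p (pt 1)" if z: "z > 0" for z
  proof (rule DERIV_unique[OF deriv[OF z]])
    show "((\<lambda>c. p (c *\<^sub>R pt z) - inverse c ^ 2 * p (pt z)) has_real_derivative
        partial 1 p (pt 1) + 1 * partial 3 p (pt 1) + 2 * p (pt 1)) (at 1)"
      by (rule has_field_derivative_transform_within_open[OF deriv[OF zero_less_one], of "{0<..}"])
        (use const[OF _ z] in auto)
  qed
  then show ?thesis by (intro that) (simp add: algebra_simps)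
qed

section \<open>Derivatives of the velocity on the line, expressed by the profile\<close>

lemma infinitesimal_rotation:
  assumes x: "x \<in> half_space"
  shows "x $ 1 *\<^sub>R partial 2 u x - x $ 2 *\<^sub>R partial 1 u x = quarter_turn (u x)"
proof -
  have rot0: "rot 0 y = y" for y by (simp add: vec3_eq_iff)
  have "((\<lambda>\<alpha>. u (rot \<alpha> x)) has_vector_derivative
      (\<Sum>i\<in>UNIV. quarter_turn (rot 0 x) $ i *\<^sub>R partial i u (rot 0 x))) (at 0)"
    using has_derivative_compose[OF has_vector_derivative_rot[unfolded has_vector_derivative_def]
        has_derivative_partial[OF diff_u[OF rot_half_space[OF x]]], of 0]
    by (simp add: has_vector_derivative_def scaleR_sum_right)
  moreover have "((\<lambda>\<alpha>. u (rot \<alpha> x)) has_vector_derivative quarter_turn (u x)) (at 0)"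
    using has_vector_derivative_rot[of "u x" 0] by (simp add: symmetric[OF x] rot0)
  ultimately show ?thesis
    using vector_derivative_unique_at by (fastforce simp: sum_3 rot0)
qed

lemma Euler_u:
  assumes "x \<in> half_space"
  shows "x $ 1 *\<^sub>R partial 1 u x + x $ 2 *\<^sub>R partial 2 u x + x $ 3 *\<^sub>R partial 3 u x = - u x"
  using Euler_relation[of u x 1] diff_u homogeneous assms by simp

lemma Euler_partial_u:
  assumes "x \<in> half_space"
  shows "x $ 1 *\<^sub>R partial 1 (partial i u) x + x $ 2 *\<^sub>R partial 2 (partial i u) x
    + x $ 3 *\<^sub>R partial 3 (partial i u) x = - 2 *\<^sub>R partial i u x"
  using Euler_relation[of "partial i u" x 2] diff_partial_u partial_u_scale assms by simp

lemma partial_1_u: "z > 0 \<Longrightarrow> partial 1 u (pt z) = - u (pt z) - z *\<^sub>R partial 3 u (pt z)"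
  using Euler_u[of "pt z"] pt_half_space[of z] by (simp add: eq_diff_eq)

lemma partial_2_u: "z > 0 \<Longrightarrow> partial 2 u (pt z) = quarter_turn (u (pt z))"
  using infinitesimal_rotation[of "pt z"] pt_half_space[of z] by simp

text \<open>\<open>partial_1_u\<close> holds along the whole line and may therefore be
  differentiated in z.\<close>

lemma partial_3_1_u:
  assumes "z > 0"
  shows "partial 3 (partial 1 u) (pt z)
    = - 2 *\<^sub>R partial 3 u (pt z) - z *\<^sub>R partial 3 (partial 3 u) (pt z)"
proof -
  note line = has_vector_derivative_pt[OF diff_u[OF pt_half_space[OF assms]]]
    has_vector_derivative_pt[OF diff_partial_u[OF pt_half_space[OF assms]]]
  have "((\<lambda>z. - u (pt z) - z *\<^sub>R partial 3 u (pt z)) has_vector_derivative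
      - partial 3 u (pt z) - (z *\<^sub>R partial 3 (partial 3 u) (pt z) + 1 *\<^sub>R partial 3 u (pt z))) (at z)"
    by (intro has_vector_derivative_diff has_vector_derivative_minus has_vector_derivative_scaleR
        DERIV_ident line)
  then have "((\<lambda>z. partial 1 u (pt z)) has_vector_derivative
      - partial 3 u (pt z) - (z *\<^sub>R partial 3 (partial 3 u) (pt z) + 1 *\<^sub>R partial 3 u (pt z))) (at z)"
    by (rule has_vector_derivative_transform_within_open[of _ _ _ "{0<..}"])
      (use assms in \<open>auto simp: partial_1_u\<close>)
  from vector_derivative_unique_at[OF line(2) this] show ?thesis
    by (simp add: scaleR_2)
qed

lemma partial_1_1_u:
  assumes "z > 0"
  shows "partial 1 (partial 1 u) (pt z)
    = 2 *\<^sub>R u (pt z) + (4 * z) *\<^sub>R partial 3 u (pt z) + z\<^sup>2 *\<^sub>R partial 3 (partial 3 u) (pt z)"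
proof -
  have "partial 1 (partial 1 u) (pt z) = - 2 *\<^sub>R partial 1 u (pt z) - z *\<^sub>R partial 3 (partial 1 u) (pt z)"
    using Euler_partial_u[OF pt_half_space[OF assms], of 1] by (simp add: eq_diff_eq)
  then show ?thesis
    by (simp add: partial_1_u[OF assms] partial_3_1_u[OF assms] vec3_eq_iff algebra_simps power2_eq_square)
qed

text \<open>\<open>partial_2_u\<close> is confined to the line, which is transversal to the second
  axis. The rotation relation is therefore differentiated along \<open>y\<close>, where its
  coefficients are 1 and \<open>t\<close>.\<close>

lemma partial_2_2_u:
  assumes "z > 0"
  shows "partial 2 (partial 2 u) (pt z) = partial 1 u (pt z) + quarter_turn (partial 2 u (pt z))"
proof -
  note [simp] = pt_half_space[OF assms]
  define y where "y t = pt z + t *\<^sub>R axis 2 1" for t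
  have y: "y t \<in> half_space" "y t $ 1 = 1" "y t $ 2 = t" "y 0 = pt z" for t
    using assms by (simp_all add: y_def half_space_def axis_def)
  note line = has_vector_derivative_partial_line[of _ "pt z" 0 2, folded y_def, unfolded y(4)]
  interpret J: bounded_linear quarter_turn by (rule bounded_linear_quarter_turn)
  have "((\<lambda>t. t *\<^sub>R partial 1 u (y t) + quarter_turn (u (y t))) has_vector_derivative
      (0 *\<^sub>R partial 2 (partial 1 u) (pt z) + 1 *\<^sub>R partial 1 u (y 0))
      + quarter_turn (partial 2 u (pt z))) (at 0)"
    by (intro has_vector_derivative_add has_vector_derivative_scaleR DERIV_ident
        J.has_vector_derivative line diff_u diff_partial_u) simp_all
  moreover have "t *\<^sub>R partial 1 u (y t) + quarter_turn (u (y t)) = partial 2 u (y t)" for t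
    using infinitesimal_rotation[OF y(1), of t] by (simp add: y diff_eq_eq add.commute)
  ultimately have "((\<lambda>t. partial 2 u (y t)) has_vector_derivative
      partial 1 u (pt z) + quarter_turn (partial 2 u (pt z))) (at 0)"
    by (simp add: y)
  moreover have "((\<lambda>t. partial 2 u (y t)) has_vector_derivative partial 2 (partial 2 u) (pt z)) (at 0)"
    by (intro line diff_partial_u) simp
  ultimately show ?thesis using vector_derivative_unique_at by blast
qed

text \<open>On \<open>y\<close> the first coordinate is 0, and the derivative of the rotation
  relation at t = 0 shows that the partial derivatives of u_1 in x_1 and of u_2 in x_2 agree. Since
  \<open>partial 3 u n\<close> is \<open>- u n\<close> by the Euler relation, zero divergence gives
  the factor 2.\<close>

lemma partial_on_axis:
  defines "n \<equiv> axis 3 1 :: real^3"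
  shows "u n $ 1 = 0" "u n $ 2 = 0" "u n $ 3 = 2 * partial 1 u n $ 1"
proof -
  have n: "n \<in> half_space" by (simp add: n_def half_space_def axis_def)
  have n_nth: "n $ 1 = 0" "n $ 2 = 0" "n $ 3 = 1" by (simp_all add: n_def axis_def)
  show "u n $ 1 = 0" "u n $ 2 = 0"
    using infinitesimal_rotation[OF n] by (simp_all add: n_nth vec3_eq_iff)
  define y where "y t = n + t *\<^sub>R axis 2 1" for t
  have y: "y t \<in> half_space" "y t $ 1 = 0" "y t $ 2 = t" "y 0 = n" for t
    using n n_nth by (simp_all add: y_def half_space_def axis_def)
  note line = has_vector_derivative_partial_line[of _ n 0 2, folded y_def, unfolded y(4)]
  interpret J: bounded_linear quarter_turn by (rule bounded_linear_quarter_turn)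
  have "((\<lambda>t. t *\<^sub>R partial 1 u (y t)) has_vector_derivative
      0 *\<^sub>R partial 2 (partial 1 u) n + 1 *\<^sub>R partial 1 u (y 0)) (at 0)"
    by (intro has_vector_derivative_scaleR DERIV_ident line diff_partial_u n)
  moreover have "((\<lambda>t. - quarter_turn (u (y t))) has_vector_derivative - quarter_turn (partial 2 u n)) (at 0)"
    by (intro has_vector_derivative_minus J.has_vector_derivative line diff_u n)
  moreover have "- quarter_turn (u (y t)) = t *\<^sub>R partial 1 u (y t)" for t
    using infinitesimal_rotation[OF y(1), of t, symmetric] by (simp add: y)
  ultimately have J: "partial 1 u n = - quarter_turn (partial 2 u n)"
    using vector_derivative_unique_at[of "\<lambda>t. t *\<^sub>R partial 1 u (y t)" _ 0] by (simp add: y)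
  have "partial 3 u n = - u n" using Euler_u[OF n] by (simp add: n_nth)
  then show "u n $ 3 = 2 * partial 1 u n $ 1"
    using divergence_free[OF n] J by (simp add: divergence_def sum_3 vec3_eq_iff)
qed

text \<open>In the Laplacian two quarter turns of \<open>v\<close> cancel the horizontal part of
  \<open>v\<close>. In the second component of the convection the products of \<open>v $ 1\<close>
  and \<open>v $ 2\<close> cancel. This is why the swirl equation has no zeroth order term.\<close>

lemma momentum_on_line:
  fixes z :: real
  defines "v \<equiv> u (pt z)" and "d \<equiv> partial 3 u (pt z)" and "e \<equiv> partial 3 (partial 3 u) (pt z)"
  assumes z: "z > 0"
  shows "d $ 3 = z * d $ 1"
    and "(1 + z\<^sup>2) * e $ 1 + 3 * z * d $ 1
      = (v $ 3 - z * v $ 1) * d $ 1 - (v $ 1)\<^sup>2 - (v $ 2)\<^sup>2 + partial 1 p (pt z)"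
    and "(1 + z\<^sup>2) * e $ 2 + 3 * z * d $ 2 = (v $ 3 - z * v $ 1) * d $ 2"
    and "(1 + z\<^sup>2) * e $ 3 + 3 * z * d $ 3 + v $ 3
      = (v $ 3 - z * v $ 1) * d $ 3 - v $ 1 * v $ 3 + partial 3 p (pt z)"
proof -
  note x = pt_half_space[OF z]
  have d1: "partial 1 u (pt z) = - v - z *\<^sub>R d" and d2: "partial 2 u (pt z) = quarter_turn v"
    using partial_1_u[OF z] partial_2_u[OF z] by (simp_all add: v_def d_def)
  show "d $ 3 = z * d $ 1"
    using divergence_free[OF x] by (simp add: divergence_def sum_3 d1 d2 d_def[symmetric])
  have "gradient p (pt z) = (1 + z\<^sup>2) *\<^sub>R e + (3 * z) *\<^sub>R d + v + quarter_turn (quarter_turn v)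
      - (v $ 1 *\<^sub>R (- v - z *\<^sub>R d) + v $ 2 *\<^sub>R quarter_turn v + v $ 3 *\<^sub>R d)"
    unfolding momentum[OF x] laplacian_def convection_def sum_3 partial_1_1_u[OF z]
      partial_2_2_u[OF z] d1 d2 v_def[symmetric] d_def[symmetric] e_def[symmetric]
    by (simp add: vec3_eq_iff algebra_simps)
  then have g: "partial i p (pt z) = ((1 + z\<^sup>2) *\<^sub>R e + (3 * z) *\<^sub>R d + v + quarter_turn (quarter_turn v)
      - (v $ 1 *\<^sub>R (- v - z *\<^sub>R d) + v $ 2 *\<^sub>R quarter_turn v + v $ 3 *\<^sub>R d)) $ i" for i
    by (simp add: gradient_def vec_eq_iff)
  show "(1 + z\<^sup>2) * e $ 1 + 3 * z * d $ 1
      = (v $ 3 - z * v $ 1) * d $ 1 - (v $ 1)\<^sup>2 - (v $ 2)\<^sup>2 + partial 1 p (pt z)"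
    unfolding g by (simp add: algebra_simps power2_eq_square)
  have "partial 2 p (pt z) = 0"
    using angular_pressure_gradient[OF x] by simp
  then show "(1 + z\<^sup>2) * e $ 2 + 3 * z * d $ 2 = (v $ 3 - z * v $ 1) * d $ 2"
    unfolding g by (simp add: algebra_simps)
  show "(1 + z\<^sup>2) * e $ 3 + 3 * z * d $ 3 + v $ 3
      = (v $ 3 - z * v $ 1) * d $ 3 - v $ 1 * v $ 3 + partial 3 p (pt z)"
    unfolding g by (simp add: algebra_simps)
qed

lemma pt_eq_scaleR:
  assumes "z > 0"
  shows "pt z = z *\<^sub>R (axis 3 1 + (1 / z) *\<^sub>R axis 1 1)"
  using assms by (simp add: vec3_eq_iff axis_def)

text \<open>With t = 1 / z, homogeneity gives \<open>u (pt z) = t *\<^sub>R w t\<close>, so the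
  behaviour for large z is the first order expansion of \<open>u\<close> at the axis point
  \<open>n\<close>.\<close>

lemma profile_limits:
  defines "a \<equiv> partial 1 u (axis 3 1) $ 1"
  shows "((\<lambda>z. z\<^sup>2 * u (pt z) $ 1) \<longlongrightarrow> a) at_top"
    and "((\<lambda>z. u (pt z) $ 2) \<longlongrightarrow> 0) at_top"
    and "((\<lambda>z. z * u (pt z) $ 3) \<longlongrightarrow> 2 * a) at_top"
proof -
  define n where "n = (axis 3 1 :: real^3)"
  define w where "w t = u (n + t *\<^sub>R axis 1 1)" for t
  have n: "n \<in> half_space" by (simp add: n_def half_space_def axis_def)
  have w0: "w 0 = u n" by (simp add: w_def)
  have "((\<lambda>t. u (n + t *\<^sub>R axis 1 1)) has_vector_derivative partial 1 u n) (at 0)"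
    using has_vector_derivative_partial_line[of u n 0 1] diff_u[OF n] by simp
  then have w: "(w has_vector_derivative partial 1 u n) (at 0)" by (simp add: w_def[abs_def])
  have "((\<lambda>t. w t $ 1) has_vector_derivative partial 1 u n $ 1) (at 0)"
    using bounded_linear.has_vector_derivative[OF bounded_linear_vec_nth w] .
  then have q: "((\<lambda>t. w t $ 1 / t) \<longlongrightarrow> a) (at 0)"
    using partial_on_axis(1)
    by (simp add: has_real_derivative_iff_has_vector_derivative[symmetric] has_field_derivative_iff
        w0 a_def n_def)
  have inv0: "filterlim (\<lambda>z::real. 1 / z) (at 0) at_top" by real_asymp
  then have inv: "((\<lambda>z::real. 1 / z) \<longlongrightarrow> 0) at_top" by (simp add: filterlim_at)
  have "isCont w 0"
    using has_vector_derivative_continuous[OF w] .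
  then have w_lim: "((\<lambda>z. w (1 / z)) \<longlongrightarrow> u n) at_top"
    using isCont_tendsto_compose[OF _ inv, of w] by (simp add: w0)
  have u_pt: "\<forall>\<^sub>F z in at_top. u (pt z) = (1 / z) *\<^sub>R w (1 / z) \<and> z > 0"
    using eventually_gt_at_top[of 0]
  proof eventually_elim
    case (elim z)
    have "n + (1 / z) *\<^sub>R axis 1 1 \<in> half_space"
      using elim by (simp add: n_def half_space_def axis_def)
    then show ?case
      using elim homogeneous[of "n + (1 / z) *\<^sub>R axis 1 1" z]
      by (simp add: pt_eq_scaleR n_def[symmetric] w_def divide_inverse)
  qed
  have "((\<lambda>z. w (1 / z) $ 1 / (1 / z)) \<longlongrightarrow> a) at_top"
    using filterlim_compose[OF q inv0] .
  moreover have "\<forall>\<^sub>F z in at_top. w (1 / z) $ 1 / (1 / z) = z\<^sup>2 * u (pt z) $ 1"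
    using u_pt by eventually_elim (simp add: power2_eq_square)
  ultimately show "((\<lambda>z. z\<^sup>2 * u (pt z) $ 1) \<longlongrightarrow> a) at_top"
    by (rule Lim_transform_eventually)
  have "((\<lambda>z. (1 / z) * w (1 / z) $ 2) \<longlongrightarrow> 0 * u n $ 2) at_top"
    by (intro tendsto_mult inv tendsto_vec_nth w_lim)
  moreover have "\<forall>\<^sub>F z in at_top. (1 / z) * w (1 / z) $ 2 = u (pt z) $ 2"
    using u_pt by eventually_elim simp
  ultimately show "((\<lambda>z. u (pt z) $ 2) \<longlongrightarrow> 0) at_top"
    using Lim_transform_eventually by fastforce
  have "((\<lambda>z. w (1 / z) $ 3) \<longlongrightarrow> 2 * a) at_top"
    using tendsto_vec_nth[OF w_lim, of 3] partial_on_axis(3) by (simp add: a_def n_def)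
  moreover have "\<forall>\<^sub>F z in at_top. w (1 / z) $ 3 = z * u (pt z) $ 3"
    using u_pt by eventually_elim simp
  ultimately show "((\<lambda>z. z * u (pt z) $ 3) \<longlongrightarrow> 2 * a) at_top"
    by (rule Lim_transform_eventually)
qed

lemma vanishes_if_vanishes_on_line:
  assumes line: "\<And>z. z > 0 \<Longrightarrow> u (pt z) = 0" and x: "x \<in> half_space"
  shows "u x = 0"
proof (cases "x $ 1 \<noteq> 0 \<or> x $ 2 \<noteq> 0")
  case True
  obtain \<rho> \<phi> \<theta> where *: "\<rho> > 0" "0 < \<phi>" "\<phi> < pi / 2" and x_eq: "x = \<rho> *\<^sub>R e_rho \<theta> \<phi>"
    using spherical_coordinates[of x] x True unfolding half_space_def by blast
  have pos: "sin \<phi> > 0" "cos \<phi> > 0"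
    using * by (auto intro: sin_gt_zero cos_gt_zero)
  have "x = (\<rho> * sin \<phi>) *\<^sub>R rot \<theta> (pt (cos \<phi> / sin \<phi>))"
    using pos by (simp add: x_eq vec3_eq_iff e_rho_def)
  moreover have "pt (cos \<phi> / sin \<phi>) \<in> half_space" using pos by (intro pt_half_space) simp
  moreover have "rot \<theta> (0 :: real^3) = 0" by (simp add: vec3_eq_iff)
  ultimately show ?thesis
    using * pos by (simp add: homogeneous rot_half_space symmetric line)
next
  case False
  \<comment> \<open>On the axis \<open>u\<close> is fixed by the number a of
    \<open>profile_limits\<close>, which is now the limit of the zero function.\<close>
  have "\<forall>\<^sub>F z in at_top. z\<^sup>2 * u (pt z) $ 1 = 0"
    using eventually_gt_at_top[of 0] by eventually_elim (simp add: line)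
  with profile_limits(1) have "((\<lambda>z. 0) \<longlongrightarrow> partial 1 u (axis 3 1) $ 1) (at_top :: real filter)"
    by (rule Lim_transform_eventually)
  then have "partial 1 u (axis 3 1) $ 1 = 0"
    using tendsto_unique[OF trivial_limit_at_top_linorder] tendsto_const by blast
  then have "u (axis 3 1) = 0"
    using partial_on_axis by (simp add: vec3_eq_iff)
  moreover have "x = x $ 3 *\<^sub>R axis 3 1" "x $ 3 > 0" "(axis 3 1 :: real^3) \<in> half_space"
    using False x by (simp_all add: vec3_eq_iff axis_def half_space_def)
  ultimately show ?thesis
    using homogeneous[of "axis 3 1" "x $ 3"] by (metis scaleR_zero_right)
qed

lemma vanishes_on_line:
  assumes cont: "continuous_on {0..} (\<lambda>z. u (pt z))" and impermeable: "u (pt 0) $ 3 = 0"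
    and bc: "u (pt 0) $ 1 = 0 \<and> u (pt 0) $ 2 = 0 \<or>
      (\<exists>D. ((\<lambda>z. u (pt z)) has_vector_derivative D) (at 0 within {0..}) \<and> D $ 1 = 0 \<and> D $ 2 = 0)"
    and z: "z > 0"
  shows "u (pt z) = 0"
proof -
  have v: "((\<lambda>z. u (pt z) $ i) has_real_derivative partial 3 u (pt z) $ i) (at z)" if "z > 0" for i z
    using bounded_linear.has_vector_derivative[OF bounded_linear_vec_nth
        has_vector_derivative_pt[OF diff_u[OF pt_half_space[OF that]]]]
    by (simp add: has_real_derivative_iff_has_vector_derivative)
  have d: "((\<lambda>z. partial 3 u (pt z) $ i) has_real_derivative partial 3 (partial 3 u) (pt z) $ i) (at z)"
    if "z > 0" for i z
    using bounded_linear.has_vector_derivative[OF bounded_linear_vec_nth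
        has_vector_derivative_pt[OF diff_partial_u[OF pt_half_space[OF that]]]]
    by (simp add: has_real_derivative_iff_has_vector_derivative)
  have q: "((\<lambda>z. p (pt z)) has_real_derivative partial 3 p (pt z)) (at z)" if "z > 0" for z
    using has_vector_derivative_pt[OF diff_p[OF pt_half_space[OF that]]]
    by (simp add: has_real_derivative_iff_has_vector_derivative)
  obtain k where k: "\<And>z. z > 0 \<Longrightarrow> partial 1 p (pt z) = k - 2 * p (pt z) - z * partial 3 p (pt z)"
    using pressure_on_line by blast
  have cont_nth: "continuous_on {0..} (\<lambda>z. u (pt z) $ i)" for i
    by (intro continuous_intros cont)
  have bc': "u (pt 0) $ 1 = 0 \<and> u (pt 0) $ 2 = 0 \<or>
      ((\<lambda>z. u (pt z) $ 1) has_real_derivative 0) (at 0 within {0..}) \<and>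
      ((\<lambda>z. u (pt z) $ 2) has_real_derivative 0) (at 0 within {0..}) \<and>
      (\<exists>D. ((\<lambda>z. u (pt z) $ 3) has_real_derivative D) (at 0 within {0..}))"
    using bc
  proof (elim disjE exE conjE)
    fix D
    assume D: "((\<lambda>z. u (pt z)) has_vector_derivative D) (at 0 within {0..})" "D $ 1 = 0" "D $ 2 = 0"
    have "((\<lambda>z. u (pt z) $ i) has_real_derivative D $ i) (at 0 within {0..})" for i
      using bounded_linear.has_vector_derivative[OF bounded_linear_vec_nth D(1)]
      by (simp add: has_real_derivative_iff_has_vector_derivative)
    from this[of 1] this[of 2] this[of 3] D(2,3) show ?thesis by auto
  qed blast
  have mom1: "(1 + z\<^sup>2) * partial 3 (partial 3 u) (pt z) $ 1 + 3 * z * partial 3 u (pt z) $ 1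
      = (u (pt z) $ 3 - z * u (pt z) $ 1) * partial 3 u (pt z) $ 1 - (u (pt z) $ 1)\<^sup>2 - (u (pt z) $ 2)\<^sup>2
        + (k - 2 * p (pt z) - z * partial 3 p (pt z))" if "z > 0" for z
    using momentum_on_line(2)[OF that] k[OF that] by simp
  have "u (pt z) $ 1 = 0 \<and> u (pt z) $ 2 = 0 \<and> u (pt z) $ 3 = 0"
    by (rule profile_vanishes[where ?v1.0 = "\<lambda>z. u (pt z) $ 1" and ?v2.0 = "\<lambda>z. u (pt z) $ 2"
          and ?v3.0 = "\<lambda>z. u (pt z) $ 3" and ?d1.0 = "\<lambda>z. partial 3 u (pt z) $ 1"
          and ?d2.0 = "\<lambda>z. partial 3 u (pt z) $ 2" and ?d3.0 = "\<lambda>z. partial 3 u (pt z) $ 3"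
          and ?e1.0 = "\<lambda>z. partial 3 (partial 3 u) (pt z) $ 1"
          and ?e2.0 = "\<lambda>z. partial 3 (partial 3 u) (pt z) $ 2"
          and ?e3.0 = "\<lambda>z. partial 3 (partial 3 u) (pt z) $ 3"
          and q = "\<lambda>z. p (pt z)" and r = "\<lambda>z. partial 3 p (pt z)", OF v v v d d d q momentum_on_line(1) mom1 momentum_on_line(3,4)
          cont_nth cont_nth cont_nth impermeable bc' profile_limits z])
  then show ?thesis by (simp add: vec3_eq_iff)
qed

end

section \<open>Boundary conditions\<close>

lemma closure_half_space: "closure half_space = {x. x $ 3 \<ge> 0}"
proof -
  have "half_space = {x. axis 3 1 \<bullet> x > 0}" by (simp add: half_space_def inner_axis')
  then show ?thesis
    using closure_halfspace_gt[of "axis 3 1 :: real^3" 0] by (simp add: inner_axis')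
qed

lemma frontier_half_space: "frontier half_space = {x. x $ 3 = 0}"
  using open_half_space unfolding frontier_def closure_half_space
  by (auto simp: interior_open half_space_def)

lemma outer_normal_eq: "outer_normal = - axis 3 1"
  by (simp add: vec3_eq_iff outer_normal_def axis_def)

lemma has_normal_derivative_reflect:
  assumes "has_normal_derivative u D x"
  shows "((\<lambda>s. u (x + s *\<^sub>R axis 3 1)) has_vector_derivative - D) (at 0 within {0..})"
proof -
  have "uminus ` {0..} = {..0::real}" by auto
  moreover have "((\<lambda>s. - s :: real) has_vector_derivative - 1) (at 0 within {0..})"
    by (auto intro!: derivative_eq_intros)
  ultimately have "((\<lambda>t. u (x + t *\<^sub>R outer_normal)) \<circ> uminus has_vector_derivative - 1 *\<^sub>R D)
      (at 0 within {0..})"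
    using vector_diff_chain_within[of uminus "- 1" 0 "{0..}" "\<lambda>t. u (x + t *\<^sub>R outer_normal)" D] assms
    by (simp add: has_normal_derivative_def)
  then show ?thesis by (simp add: o_def outer_normal_eq)
qed

text \<open>The normal derivative has degree \<open>-2\<close> and the trace has degree \<open>-1\<close>, so comparing the
  condition at two points of a ray separates its two terms.\<close>

lemma tangential_trace_vanishes:
  assumes bc: "Navier_boundary_condition \<gamma> u" and hom: "minus_one_homogeneous u"
    and "0 < \<gamma>" "\<gamma> \<le> 1"
  shows "u (axis 1 1) $ 1 = 0 \<and> u (axis 1 1) $ 2 = 0"
proof (cases "\<gamma> = 1")
  case True
  have "axis 1 1 \<in> frontier half_space - {0 :: real^3}"
    by (simp add: frontier_half_space axis_def vec3_eq_iff)
  then have "cross3 (u (axis 1 1)) outer_normal = 0"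
    using bc True by (auto simp: Navier_boundary_condition_def)
  then show ?thesis by (simp add: cross3_def outer_normal_def vec3_eq_iff)
next
  case False
  define a :: "real^3" where "a = axis 1 1"
  define n :: "real^3" where "n = axis 3 1"
  have a: "a \<in> frontier half_space - {0}" "2 *\<^sub>R a \<in> frontier half_space - {0}"
    by (simp_all add: a_def frontier_half_space axis_def vec3_eq_iff)
  have cont: "continuous_on (closure half_space - {0}) u"
    using bc by (simp add: Navier_boundary_condition_def)
  obtain D where D: "has_normal_derivative u D a"
    and crossD: "cross3 ((1 - \<gamma>) *\<^sub>R D + \<gamma> *\<^sub>R u a) outer_normal = 0"
    using bc a(1) False unfolding Navier_boundary_condition_def by blast
  obtain E where E: "has_normal_derivative u E (2 *\<^sub>R a)"
    and crossE: "cross3 ((1 - \<gamma>) *\<^sub>R E + \<gamma> *\<^sub>R u (2 *\<^sub>R a)) outer_normal = 0"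
    using bc a(2) False unfolding Navier_boundary_condition_def by blast
  \<comment> \<open>Homogeneity is assumed in the open half space; continuity carries it to the
    boundary points as \<open>u2a\<close>.\<close>
  have interior: "u (2 *\<^sub>R a + s *\<^sub>R n) = (1 / 2) *\<^sub>R u (a + (s / 2) *\<^sub>R n)" if "s > 0" for s
  proof -
    have "a + (s / 2) *\<^sub>R n \<in> half_space" using that by (simp add: half_space_def a_def n_def axis_def)
    then have "u (2 *\<^sub>R (a + (s / 2) *\<^sub>R n)) = inverse 2 *\<^sub>R u (a + (s / 2) *\<^sub>R n)"
      using hom by (simp add: minus_one_homogeneous_def)
    then show ?thesis by (simp add: scaleR_add_right)
  qed
  have trace: "((\<lambda>s. u (b + s *\<^sub>R n)) \<longlongrightarrow> u b) (at_right 0)" if "b \<in> {a, 2 *\<^sub>R a}" for b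
  proof -
    have "continuous_on {0..} (\<lambda>s. u (b + s *\<^sub>R n))"
      using that by (intro continuous_on_compose2[OF cont] continuous_intros)
        (auto simp: closure_half_space a_def n_def axis_def vec3_eq_iff)
    then have "((\<lambda>s. u (b + s *\<^sub>R n)) \<longlongrightarrow> u (b + 0 *\<^sub>R n)) (at 0 within {0..})"
      unfolding continuous_on_def by (rule bspec) simp
    then show ?thesis by (simp add: at_within_Ici_at_right)
  qed
  have half: "filterlim (\<lambda>s::real. s / 2) (at_right 0) (at_right 0)"
    by real_asymp
  have "((\<lambda>s. (1 / 2) *\<^sub>R u (a + (s / 2) *\<^sub>R n)) \<longlongrightarrow> (1 / 2) *\<^sub>R u a) (at_right 0)"
    by (intro tendsto_scaleR tendsto_const filterlim_compose[OF trace half]) simp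
  moreover have "\<forall>\<^sub>F s in at_right 0. (1 / 2) *\<^sub>R u (a + (s / 2) *\<^sub>R n) = u (2 *\<^sub>R a + s *\<^sub>R n)"
    by (auto simp: eventually_at_right_field interior intro!: exI[of _ 1])
  ultimately have "((\<lambda>s. u (2 *\<^sub>R a + s *\<^sub>R n)) \<longlongrightarrow> (1 / 2) *\<^sub>R u a) (at_right 0)"
    by (rule Lim_transform_eventually)
  then have u2a: "u (2 *\<^sub>R a) = (1 / 2) *\<^sub>R u a"
    using tendsto_unique[OF trivial_limit_at_right_real] trace[of "2 *\<^sub>R a"] by blast
  define f where "f s = u (a + s *\<^sub>R n)" for s
  have f: "(f has_vector_derivative - D) (at 0 within {0..})"
    using has_normal_derivative_reflect[OF D] by (simp add: f_def[abs_def] n_def)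
  have "(\<lambda>s. s / 2) ` {0..} = {0::real..}"
  proof
    show "{0::real..} \<subseteq> (\<lambda>s. s / 2) ` {0..}"
      by (intro subsetI image_eqI[of _ _ "2 * _"]) auto
  qed auto
  then have "(f \<circ> (\<lambda>s. s / 2) has_vector_derivative (1 / 2) *\<^sub>R (- D)) (at 0 within {0..})"
    using f by (intro vector_diff_chain_within) (auto intro!: derivative_eq_intros)
  from bounded_linear.has_vector_derivative[OF bounded_linear_scaleR_right[of "1 / 2"] this]
  have "((\<lambda>s. (1 / 2) *\<^sub>R f (s / 2)) has_vector_derivative (1 / 2) *\<^sub>R (1 / 2) *\<^sub>R (- D))
      (at 0 within {0..})"
    by (simp only: o_def)
  moreover have "(1 / 2) *\<^sub>R f (s / 2) = u (2 *\<^sub>R a + s *\<^sub>R n)" if "s \<in> {0..}" for s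
    using that interior[of s] u2a by (cases "s = 0") (auto simp: f_def)
  ultimately have "((\<lambda>s. u (2 *\<^sub>R a + s *\<^sub>R n)) has_vector_derivative (1 / 2) *\<^sub>R (1 / 2) *\<^sub>R (- D))
      (at 0 within {0..})"
    by (metis (no_types, lifting) atLeast_iff order_refl has_vector_derivative_transform)
  moreover have "((\<lambda>s. u (2 *\<^sub>R a + s *\<^sub>R n)) has_vector_derivative - E) (at 0 within {0..})"
    using has_normal_derivative_reflect[OF E] by (simp only: n_def)
  moreover have "at 0 within {0..} \<noteq> (bot :: real filter)"
    by (simp add: at_within_Ici_at_right trivial_limit_at_right_real)
  ultimately have "(1 / 2) *\<^sub>R (1 / 2) *\<^sub>R (- D) = - E"
    using vector_derivative_unique_within by blast
  then have "E = (1 / 2) *\<^sub>R (1 / 2) *\<^sub>R D"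
    by (simp add: eq_commute[of E])
  then have ED: "E $ i = D $ i / 4" for i by simp
  \<comment> \<open>With X = (1 - \<gamma>) D_i and Y = \<gamma> u_i at \<open>a\<close>, the
    conditions at \<open>a\<close> and at twice \<open>a\<close> read X + Y = 0 and X / 4 + Y / 2 =
    0, so Y = 0.\<close>
  have "\<gamma> * u a $ i = 0" if "i \<in> {1, 2}" for i
  proof -
    have "(1 - \<gamma>) * D $ i + \<gamma> * u a $ i = 0" "((1 - \<gamma>) * D $ i) / 4 + (\<gamma> * u a $ i) / 2 = 0"
      using crossD crossE that by (auto simp: cross3_def outer_normal_def vec3_eq_iff ED u2a)
    then show ?thesis by linarith
  qed
  then show ?thesis using \<open>0 < \<gamma>\<close> by (auto simp: a_def)
qed

lemma axisymmetric_flowI: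
  assumes NS: "stationary_Navier_Stokes u p" and hom: "minus_one_homogeneous u"
    and sym: "axially_symmetric u"
  shows "axisymmetric_flow u p"
proof
  have C: "C_on (Suc (Suc 0)) u half_space" "C_on (Suc 0) p half_space"
    using NS by (simp_all add: stationary_Navier_Stokes_def numeral_2_eq_2)
  show diff_u: "u differentiable at x" if "x \<in> half_space" for x
    using C that by simp
  show "partial i u differentiable at x" if "x \<in> half_space" for x i
    using C that by simp
  show "p differentiable at x" if "x \<in> half_space" for x
    using C that by simp
  show "gradient p x = laplacian u x - convection u u x" "divergence u x = 0"
    if "x \<in> half_space" for x
    using NS that unfolding stationary_Navier_Stokes_def by (auto simp: algebra_simps eq_neg_iff_add_eq_0)
  show "u (c *\<^sub>R x) = inverse c *\<^sub>R u x" if "x \<in> half_space" "c > 0" for x c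
    using hom that by (simp add: minus_one_homogeneous_def)
  have "continuous_on half_space u"
    by (intro continuous_at_imp_continuous_on ballI differentiable_imp_continuous_within diff_u)
  then show "u (rot \<alpha> x) = rot \<alpha> (u x)" if "x \<in> half_space" for x \<alpha>
    using axially_symmetric_rot sym that by blast
qed

theorem theorem5p1:
  fixes u :: "real^3 \<Rightarrow> real^3" and p :: "real^3 \<Rightarrow> real" and \<gamma> :: real
  assumes "0 \<le> \<gamma>" and "\<gamma> \<le> 1"
    and "stationary_Navier_Stokes u p"
    and "Navier_boundary_condition \<gamma> u"
    and "minus_one_homogeneous u"
    and "axially_symmetric u"
  shows "\<forall>x\<in>half_space. u x = 0"
proof -
  interpret axisymmetric_flow u p
    using assms by (intro axisymmetric_flowI)
  have pt: "pt z = axis 1 1 + z *\<^sub>R axis 3 1" for z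
    by (simp add: vec3_eq_iff axis_def)
  have pt0: "pt 0 \<in> frontier half_space - {0}"
    by (simp add: frontier_half_space vec3_eq_iff)
  have bc: "continuous_on (closure half_space - {0}) u" "u (pt 0) \<bullet> outer_normal = 0"
    using assms(4) pt0 by (auto simp: Navier_boundary_condition_def)
  have cont: "continuous_on {0..} (\<lambda>z. u (pt z))"
    unfolding pt by (intro continuous_on_compose2[OF bc(1)] continuous_intros)
      (auto simp: closure_half_space vec3_eq_iff axis_def)
  have "u (pt 0) $ 3 = 0"
    using bc(2) by (simp add: inner_vec_def sum_3 outer_normal_def)
  moreover have "u (pt 0) $ 1 = 0 \<and> u (pt 0) $ 2 = 0 \<or>
      (\<exists>D. ((\<lambda>z. u (pt z)) has_vector_derivative D) (at 0 within {0..}) \<and> D $ 1 = 0 \<and> D $ 2 = 0)"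
  \<comment> \<open>Only \<gamma> = 0 leads to the slip alternative; every positive \<gamma> forces
    the tangential trace to vanish.\<close>
  proof (cases "\<gamma> = 0")
    case True
    then obtain D where D: "has_normal_derivative u D (pt 0)" "cross3 D outer_normal = 0"
      using assms(4) pt0 unfolding Navier_boundary_condition_def by fastforce
    have "((\<lambda>z. u (pt z)) has_vector_derivative - D) (at 0 within {0..})"
      using has_normal_derivative_reflect[OF D(1)] by (simp add: pt)
    moreover have "(- D) $ 1 = 0" "(- D) $ 2 = 0"
      using D(2) by (simp_all add: cross3_def outer_normal_def vec3_eq_iff)
    ultimately show ?thesis by blast
  next
    case False
    then show ?thesis
      using tangential_trace_vanishes[OF assms(4,5)] assms(1,2) by (simp add: pt)
  qed
  ultimately have "u (pt z) = 0" if "z > 0" for z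
    using vanishes_on_line cont that by blast
  then show ?thesis
    using vanishes_if_vanishes_on_line by blast
qed

end
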